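(* For finite trees $T_1$ and $T_2$, we have $\mathcal{B}_3(T_1)\cong \mathcal{B}_3(T_2)$ if and only if $T_1\cong T_2$.
   Context: A stable $k$-partition of a graph $G$ is a multiset $P=\{V_1,\dots,V_k\}$ of $k$ independent sets of $G$ (some possibly empty) that partition $V(G)$. For $v\in V(G)$, $P-v$ denotes the multiset $\{V_i\setminus\{v\}:1\le i\le k\}$. The Bell $k$-coloring graph $\mathcal{B}_k(G)$ has as vertices all stable $k$-partitions of $G$, and two distinct partitions $P,Q$ are adjacent if and only if $P-v=Q-v$ for some $v\in V(G)$.
   Formalization: The pair consisting of the one-vertex tree and the two-vertex tree is excluded, because both have a one-vertex Bell 3-coloring graph although they are not isomorphic; all other pairs of finite trees are covered. *)

theory Defs
  imports
    "HOL-Library.Multiset"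
    "HOL-Library.Disjoint_Sets"
    "Graph_Theory.Graph_Theory"
begin

text \<open>
  A finite simple graph is a \<^locale>\<open>pair_graph\<close>: a finite loop-free symmetric digraph whose arcs
  are pairs, each edge \<open>uv\<close> being represented by the two arcs \<open>(u, v)\<close> and \<open>(v, u)\<close>.

  The library constant \<^const>\<open>Digraph_Component.tree\<close> does not fit this representation: it forbids
  all directed cycles, hence also the 2-cycle given by the two arcs of one edge. The cycles of the
  underlying undirected graph are the directed cycles of length at least 3.
\<close>

definition undirected_tree :: "'a pair_pre_digraph \<Rightarrow> bool" where
  "undirected_tree G \<longleftrightarrow>
     pair_graph G \<and> Digraph_Component.connected (with_proj G) \<and>
     \<not> (\<exists>p. pre_digraph.cycle (with_proj G) p \<and> 3 \<le> length p)"

definition independent_set :: "'a pair_pre_digraph \<Rightarrow> 'a set \<Rightarrow> bool" where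
  "independent_set G S \<longleftrightarrow> S \<subseteq> pverts G \<and> (\<forall>u\<in>S. \<forall>v\<in>S. (u, v) \<notin> parcs G)"

definition stable_partition :: "nat \<Rightarrow> 'a pair_pre_digraph \<Rightarrow> 'a set multiset \<Rightarrow> bool" where
  "stable_partition k G P \<longleftrightarrow>
     (\<exists>V. P = {# V i. i \<in># mset_set {1..k} #} \<and>
          (\<forall>i\<in>{1..k}. independent_set G (V i)) \<and>
          disjoint_family_on V {1..k} \<and>
          (\<Union>i\<in>{1..k}. V i) = pverts G)"

definition partition_minus :: "'a set multiset \<Rightarrow> 'a \<Rightarrow> 'a set multiset" where
  "partition_minus P v = {# S - {v}. S \<in># P #}"

definition bell_graph :: "nat \<Rightarrow> 'a pair_pre_digraph \<Rightarrow> 'a set multiset pair_pre_digraph" where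
  "bell_graph k G =
     \<lparr> pverts = {P. stable_partition k G P},
       parcs = {(P, Q). stable_partition k G P \<and> stable_partition k G Q \<and> P \<noteq> Q \<and>
                        (\<exists>v\<in>pverts G. partition_minus P v = partition_minus Q v)} \<rparr>"

end

theory Submission
  imports Defs "HOL-Combinatorics.Permutations"
begin

text \<open>
  Let \<open>A\<close>, \<open>B\<close> be the bipartition of a tree \<open>T\<close> with \<open>n\<close> vertices. A proper 3-colouring up to
  permutation of the colours is the same as an orientation of the edges up to global reversal, and
  (comparing with the orientation of the 2-colouring) the same as a subset \<open>X\<close> of the vertices modulo
  symmetric difference with \<open>A\<close> and \<open>B\<close>. In these terms the neighbours of \<open>X\<close> in the Bell graph
  arise by toggling a vertex whose neighbourhood is not split by \<open>X\<close>. In particular the Bell graph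
  has \<open>2 ^ (n - 2)\<close> vertices if \<open>n \<ge> 2\<close>, so it determines \<open>n\<close> apart from the coincidence of
  \<open>n = 1\<close> and \<open>n = 2\<close>.

  Let \<open>m\<close> be the size of the smaller side.
  If \<open>m \<ge> 3\<close>, the class of the empty set is the unique vertex of degree \<open>n\<close>, its neighbours are the
  classes of the singletons, and \<open>v\<close>, \<open>w\<close> are adjacent in \<open>T\<close> exactly if the classes of \<open>{v}\<close> and
  \<open>{w}\<close> have no other common neighbour.
  If \<open>m = 2\<close>, all degrees are at most \<open>n - 1\<close>, some degree is smaller, and \<open>T\<close> consists of two
  stars with \<open>p\<close> and \<open>q\<close> private leaves and one common leaf; the number of vertices of degree
  \<open>n - 1\<close> is \<open>2 ^ p + 2 ^ q - 1\<close>.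
  If \<open>m = 1\<close>, \<open>T\<close> is a star and, for \<open>n \<ge> 4\<close>, the Bell graph is regular of degree \<open>n - 1\<close>.
\<close>

section \<open>Trees grown leaf by leaf\<close>

text \<open>Both arcs of an edge enter together with the new leaf \<open>w\<close>, so the graph
  stays symmetric. Once \<open>undirected_tree_imp_grown\<close> is available, induction along this
  growth replaces all appeals to cycles.\<close>

inductive grown :: "'a set \<Rightarrow> 'a rel \<Rightarrow> bool" where
  single: "grown {r} {}"
| add_leaf: "grown V E \<Longrightarrow> v \<in> V \<Longrightarrow> w \<notin> V \<Longrightarrow> grown (insert w V) (insert (v, w) (insert (w, v) E))"

lemma grown_finite: "grown V E \<Longrightarrow> finite V"
  by (induction rule: grown.induct) auto

lemma grown_nonempty: "grown V E \<Longrightarrow> V \<noteq> {}"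
  by (induction rule: grown.induct) auto

lemma grown_arcs: "grown V E \<Longrightarrow> E \<subseteq> V \<times> V"
  by (induction rule: grown.induct) auto

lemma grown_sym: "grown V E \<Longrightarrow> sym E"
  by (induction rule: grown.induct) (auto simp: sym_def)

text \<open>A tree has one edge fewer than vertices, and each edge counts as two arcs. The additive
  form avoids truncated subtraction.\<close>

lemma grown_card_arcs: "grown V E \<Longrightarrow> card E + 2 = 2 * card V"
proof (induction rule: grown.induct)
  case (add_leaf V E v w)
  have "finite V" "E \<subseteq> V \<times> V"
    using add_leaf.hyps(1) by (auto simp: grown_finite dest: grown_arcs)
  moreover from this have "finite E"
    by (meson finite_SigmaI finite_subset)
  moreover have "(v, w) \<notin> E" "(w, v) \<notin> E" "v \<noteq> w"
    using calculation add_leaf.hyps by auto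
  ultimately show ?case
    using add_leaf.IH add_leaf.hyps by simp
qed simp

text \<open>Connectedness in the form used throughout: a property that never changes along an edge
  holds everywhere or nowhere.\<close>

lemma grown_connected:
  "grown V E \<Longrightarrow> (\<And>u v. (u, v) \<in> E \<Longrightarrow> u \<in> S \<longleftrightarrow> v \<in> S) \<Longrightarrow> V \<inter> S = {} \<or> V \<subseteq> S"
proof (induction rule: grown.induct)
  case (add_leaf V E v w)
  have "V \<inter> S = {} \<or> V \<subseteq> S"
    using add_leaf.IH add_leaf.prems by auto
  moreover have "v \<in> S \<longleftrightarrow> w \<in> S"
    using add_leaf.prems by auto
  ultimately show ?case
    using add_leaf.hyps by auto
qed auto

lemma grown_bipartition:
  "grown V E \<Longrightarrow> \<exists>A B. V = A \<union> B \<and> A \<inter> B = {} \<and> E \<subseteq> A \<times> B \<union> B \<times> A"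
proof (induction rule: grown.induct)
  case (single r)
  show ?case by (rule exI[of _ "{r}"], rule exI[of _ "{}"]) auto
next
  case (add_leaf V E v w)
  then obtain A B where AB: "V = A \<union> B" "A \<inter> B = {}" "E \<subseteq> A \<times> B \<union> B \<times> A"
    by auto
  show ?case
  proof (cases "v \<in> A")
    case True
    with AB add_leaf.hyps show ?thesis
      by (intro exI[of _ A] exI[of _ "insert w B"]) auto
  next
    case False
    with AB add_leaf.hyps show ?thesis
      by (intro exI[of _ "insert w A"] exI[of _ B]) auto
  qed
qed

text \<open>Without cycles nothing obstructs integrating an antisymmetric edge function: the
  potential at each new leaf is forced by its only edge. One application builds a colouring from a
  vertex subset, the other recovers a subset from a colouring.\<close>

lemma grown_potential:
  fixes g :: "'a \<Rightarrow> 'a \<Rightarrow> int"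
  shows "grown V E \<Longrightarrow> (\<And>u v. (u, v) \<in> E \<Longrightarrow> g u v = - g v u) \<Longrightarrow>
    \<exists>f. \<forall>(u, v)\<in>E. f v - f u = g u v"
proof (induction rule: grown.induct)
  case (add_leaf V E v w)
  obtain f where f: "\<forall>(x, y)\<in>E. f y - f x = g x y"
    using add_leaf.IH[OF add_leaf.prems] by blast
  have "E \<subseteq> V \<times> V" using add_leaf.hyps(1) by (rule grown_arcs)
  moreover have "g w v = - g v w" by (rule add_leaf.prems) simp
  ultimately have "\<forall>(x, y)\<in>insert (v, w) (insert (w, v) E).
      (f(w := f v + g v w)) y - (f(w := f v + g v w)) x = g x y"
    using f add_leaf.hyps(2,3) by fastforce
  then show ?case by (intro exI[of _ "f(w := f v + g v w)"])
qed auto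

lemma pcas_snoc: "pcas u (p @ [e]) v \<longleftrightarrow> pcas u p (fst e) \<and> snd e = v"
  by (induction p arbitrary: u) auto

lemma pawalk_verts_snoc: "pcas u p (fst e) \<Longrightarrow> pawalk_verts u (p @ [e]) = pawalk_verts u p @ [snd e]"
  by (induction p arbitrary: u) auto

text \<open>Supplies the simple path which, together with two arcs to an outside vertex, will close
  a forbidden cycle.\<close>

lemma grown_path:
  "grown V E \<Longrightarrow> u \<in> V \<Longrightarrow> v \<in> V \<Longrightarrow>
    \<exists>p. set p \<subseteq> E \<and> pcas u p v \<and> distinct (pawalk_verts u p) \<and> set (pawalk_verts u p) \<subseteq> V"
proof (induction arbitrary: u v rule: grown.induct)
  case (single r)
  then show ?case by (intro exI[of _ "[]"]) auto
next
  case (add_leaf V E x w)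
  note IH = add_leaf.IH
  consider "u \<in> V" "v \<in> V" | "u = w" "v = w" | "u = w" "v \<in> V" | "u \<in> V" "v = w"
    using add_leaf.prems by auto
  then show ?case
  proof cases
    case 1
    then show ?thesis using IH[of u v] by blast
  next
    case 2
    then show ?thesis by (intro exI[of _ "[]"]) auto
  next
    case 3
    then obtain p where "set p \<subseteq> E" "pcas x p v" "distinct (pawalk_verts x p)"
      "set (pawalk_verts x p) \<subseteq> V"
      using IH[of x v] add_leaf.hyps by blast
    then show ?thesis using 3 add_leaf.hyps
      by (intro exI[of _ "(w, x) # p"]) auto
  next
    case 4
    then obtain p where "set p \<subseteq> E" "pcas u p x" "distinct (pawalk_verts u p)"
      "set (pawalk_verts u p) \<subseteq> V"
      using IH[of u x] add_leaf.hyps by blast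
    then show ?thesis using 4 add_leaf.hyps
      by (intro exI[of _ "p @ [(x, w)]"]) (auto simp: pcas_snoc pawalk_verts_snoc)
  qed
qed

section \<open>From connected acyclic graphs to leaf-by-leaf growth\<close>

lemma (in pair_graph) connected_imp_boundary_arc:
  assumes "Digraph_Component.connected (with_proj G)" "S \<subset> pverts G" "S \<noteq> {}"
  shows "\<exists>v\<in>S. \<exists>w\<in>pverts G - S. (v, w) \<in> parcs G"
proof (rule ccontr)
  assume no: "\<not> ?thesis"
  obtain s t where st: "s \<in> S" "t \<in> pverts G" "t \<notin> S"
    using assms(2,3) by auto
  have "strongly_connected (with_proj G)"
    using assms(1) symmetric_connected_imp_strongly_connected pair_sym_arcs
    by auto
  then have "s \<rightarrow>\<^sup>*\<^bsub>with_proj G\<^esub> t"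
    using st assms(2) by (auto simp: strongly_connected_def)
  then have "(s, t) \<in> (parcs G)\<^sup>*"
    by (auto simp: reachable_def dest: rtrancl_on_rtranclI)
  then have "t \<in> S"
    by (induction rule: rtrancl_induct) (use no st(1) in_arcsD2 in blast)+
  with st show False by simp
qed

text \<open>A simple path inside \<open>S\<close> from \<open>v\<close> to \<open>v'\<close> closes
  up through \<open>w\<close> to a cycle; \<open>v \<noteq> v'\<close> makes the path nonempty and
  the cycle of length at least 3.\<close>

lemma (in pair_graph) no_cycle_imp_unique_arc_to_grown:
  assumes "grown S F" "F \<subseteq> parcs G"
    and acyclic: "\<not> (\<exists>p. pre_digraph.cycle (with_proj G) p \<and> 3 \<le> length p)"
    and "v \<in> S" "v' \<in> S" "w \<notin> S" "(v, w) \<in> parcs G" "(v', w) \<in> parcs G"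
  shows "v = v'"
proof (rule ccontr)
  assume "v \<noteq> v'"
  obtain p where p: "set p \<subseteq> F" "pcas v p v'" "distinct (pawalk_verts v p)"
      "set (pawalk_verts v p) \<subseteq> S"
    using grown_path[OF assms(1) \<open>v \<in> S\<close> \<open>v' \<in> S\<close>] by blast
  have "p \<noteq> []" using p(2) \<open>v \<noteq> v'\<close> by auto
  let ?q = "(w, v) # p @ [(v', w)]"
  have "3 \<le> length ?q" using \<open>p \<noteq> []\<close> by (cases p) auto
  moreover have "pre_digraph.cycle (with_proj G) ?q"
  proof -
    have "pcas v (p @ [(v', w)]) w" "pawalk_verts v (p @ [(v', w)]) = pawalk_verts v p @ [w]"
      using p(2) pcas_snoc[of v p "(v', w)" w] pawalk_verts_snoc[of v p "(v', w)"]
      by (simp_all del: cas_append_iff)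
    then show ?thesis
      unfolding cycle_def awalk_def
      using p assms(2,4-8) in_arcsD2[of v w] arcs_symmetric[of v w]
      by (intro exI[of _ w]) (auto simp del: cas_append_iff)
  qed
  ultimately show False using acyclic by blast
qed

text \<open>A maximal vertex set whose induced subgraph is grown must be everything: connectedness
  offers a boundary arc, and acyclicity makes its outer end a leaf of the enlarged induced
  subgraph.\<close>

lemma undirected_tree_imp_grown:
  assumes "undirected_tree T"
  shows "grown (pverts T) (parcs T)"
proof -
  interpret pair_graph T using assms by (simp add: undirected_tree_def)
  have conn: "Digraph_Component.connected (with_proj T)"
    and acyc: "\<not> (\<exists>p. pre_digraph.cycle (with_proj T) p \<and> 3 \<le> length p)"
    using assms by (auto simp: undirected_tree_def)
  have "pverts T \<noteq> {}"
    using conn by (auto simp: connected_def strongly_connected_def)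
  then obtain r where r: "r \<in> pverts T" by auto
  let ?sub = "\<lambda>S. S \<subseteq> pverts T \<and> grown S (parcs T \<inter> S \<times> S)"
  have "?sub {r}"
  proof -
    have "parcs T \<inter> {r} \<times> {r} = {}" using no_loops' by auto
    then show ?thesis using r grown.single[of r] by simp
  qed
  moreover have "finite {S. ?sub S}"
    by (rule finite_subset[of _ "Pow (pverts T)"]) (use pair_finite_verts in auto)
  ultimately have "\<exists>S\<in>{S. ?sub S}. {r} \<subseteq> S \<and> (\<forall>S'\<in>{S. ?sub S}. S \<subseteq> S' \<longrightarrow> S = S')"
    by (intro finite_has_maximal2) simp_all
  then obtain S where S: "?sub S" and max: "\<And>S'. ?sub S' \<Longrightarrow> S \<subseteq> S' \<Longrightarrow> S = S'"
    by (elim bexE conjE) simp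
  have "S = pverts T"
  proof (rule ccontr)
    assume "S \<noteq> pverts T"
    then have "S \<subset> pverts T" "S \<noteq> {}" using S grown_nonempty by auto
    then obtain v w where vw: "v \<in> S" "w \<in> pverts T" "w \<notin> S" "(v, w) \<in> parcs T"
      using connected_imp_boundary_arc[OF conn] by blast
    have uniq: "x = v" if "x \<in> S" "(x, w) \<in> parcs T" for x
      using no_cycle_imp_unique_arc_to_grown[OF _ _ acyc that(1) vw(1,3) that(2) vw(4)] S by blast
    have "parcs T \<inter> insert w S \<times> insert w S = insert (v, w) (insert (w, v) (parcs T \<inter> S \<times> S))"
    proof (intro equalityI subrelI)
      fix x y assume xy: "(x, y) \<in> parcs T \<inter> insert w S \<times> insert w S"
      then show "(x, y) \<in> insert (v, w) (insert (w, v) (parcs T \<inter> S \<times> S))"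
        using uniq[of x] uniq[of y] no_loops'[of x y] arcs_symmetric[of x y] by fast
    next
      fix x y assume "(x, y) \<in> insert (v, w) (insert (w, v) (parcs T \<inter> S \<times> S))"
      then show "(x, y) \<in> parcs T \<inter> insert w S \<times> insert w S"
        using vw arcs_symmetric[of v w] by fast
    qed
    then have "?sub (insert w S)"
      using grown.add_leaf[OF conjunct2[OF S] vw(1,3)] S vw by simp
    then show False using max[of "insert w S"] vw(3) by blast
  qed
  moreover have "parcs T \<inter> pverts T \<times> pverts T = parcs T"
    using in_arcsD1 in_arcsD2 by auto
  ultimately show ?thesis using S by simp
qed

section \<open>Colourings and partitions\<close>

locale bipartite_tree =
  fixes V :: "'a set" and E :: "'a rel" and A B :: "'a set"
  assumes grown: "grown V E"
    and bipartition: "V = A \<union> B" "A \<inter> B = {}" "E \<subseteq> A \<times> B \<union> B \<times> A"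
begin

lemma finite_V: "finite V" and finite_A: "finite A" and finite_B: "finite B"
  using grown_finite[OF grown] bipartition by auto

lemma V_nonempty: "V \<noteq> {}"
  using grown_nonempty[OF grown] .

lemma arc_in_V: "(u, v) \<in> E \<Longrightarrow> u \<in> V" "(u, v) \<in> E \<Longrightarrow> v \<in> V"
  using grown_arcs[OF grown] by auto

lemma arc_sym: "(u, v) \<in> E \<Longrightarrow> (v, u) \<in> E"
  using grown_sym[OF grown] by (auto dest: symD)

lemma arc_side: "(u, v) \<in> E \<Longrightarrow> u \<in> A \<longleftrightarrow> v \<notin> A"
  using bipartition by auto

lemma arc_neq: "(u, v) \<in> E \<Longrightarrow> u \<noteq> v"
  using arc_side by blast

lemma closed_trivial:
  assumes "S \<subseteq> V" "\<And>u v. (u, v) \<in> E \<Longrightarrow> u \<in> S \<longleftrightarrow> v \<in> S"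
  shows "S = {} \<or> S = V"
  using grown_connected[OF grown, of S] assms by auto

lemma swap: "bipartite_tree V E B A"
  using grown bipartition by unfold_locales auto

text \<open>Under the encoding of colourings introduced below, this says that all neighbours of
  \<open>v\<close> have one colour, which is when \<open>v\<close> can change its own.\<close>

definition unsplit :: "'a set \<Rightarrow> 'a \<Rightarrow> bool" where
  "unsplit X v \<longleftrightarrow> (\<forall>u w. (v, u) \<in> E \<longrightarrow> (v, w) \<in> E \<longrightarrow> (u \<in> X \<longleftrightarrow> w \<in> X))"

end

lemma sym_diff_cancel: "sym_diff X (sym_diff X Y) = Y"
  by auto

text \<open>The three colours are placed on a directed 3-cycle; a proper 3-colouring orients each edge along it.\<close>

definition next_colour :: "nat \<Rightarrow> nat \<Rightarrow> bool" where
  "next_colour i j \<longleftrightarrow> (i, j) \<in> {(1, 2), (2, 3), (3, 1)}"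

lemma colours: "{1..3} = {1, 2, 3::nat}"
  by auto

lemma next_colour_total:
  "i \<in> {1..3} \<Longrightarrow> j \<in> {1..3} \<Longrightarrow> i \<noteq> j \<Longrightarrow> next_colour i j \<longleftrightarrow> \<not> next_colour j i"
  unfolding colours next_colour_def by (elim insertE emptyE) simp_all

lemma next_colour_unique:
  "i \<in> {1..3} \<Longrightarrow> j \<in> {1..3} \<Longrightarrow> k \<in> {1..3} \<Longrightarrow> j \<noteq> i \<Longrightarrow> k \<noteq> i \<Longrightarrow>
    (next_colour i j \<longleftrightarrow> next_colour i k) \<Longrightarrow> j = k"
  unfolding colours next_colour_def by (elim insertE emptyE) simp_all

text \<open>Recolouring a vertex from \<open>i\<close> to \<open>j\<close> beside a neighbour of the
  third colour \<open>k\<close> reverses the edge, since one arrow of the directed triangle enters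
  \<open>k\<close> and the other leaves it.\<close>

lemma next_colour_third:
  "i \<in> {1..3} \<Longrightarrow> j \<in> {1..3} \<Longrightarrow> k \<in> {1..3} \<Longrightarrow> i \<noteq> j \<Longrightarrow> k \<noteq> i \<Longrightarrow> k \<noteq> j \<Longrightarrow>
    next_colour i k \<longleftrightarrow> \<not> next_colour j k"
  unfolding colours next_colour_def by (elim insertE emptyE) simp_all

text \<open>Residues modulo 3 place an integer potential on the triangle; the \<open>+ 1\<close>
  shifts them to the colours 1, 2, 3.\<close>

lemma next_colour_mod:
  "next_colour (nat (x mod 3) + 1) (nat (y mod 3) + 1) \<longleftrightarrow> (y - x) mod 3 = 1" for x y :: int
proof -
  have "x mod 3 = 0 \<or> x mod 3 = 1 \<or> x mod 3 = 2" "y mod 3 = 0 \<or> y mod 3 = 1 \<or> y mod 3 = 2"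
    by linarith+
  moreover have "(y - x) mod 3 = (y mod 3 - x mod 3) mod 3" by (simp add: mod_diff_eq)
  ultimately show ?thesis by (elim disjE) (simp_all add: next_colour_def)
qed

text \<open>The six permutations are the rotations and the reflections of the directed
  triangle.\<close>

lemma permutation_next_colour:
  assumes "bij_betw p {1..3} {1..3::nat}"
  obtains (preserve) "\<And>i j. i \<in> {1..3} \<Longrightarrow> j \<in> {1..3} \<Longrightarrow> next_colour (p i) (p j) \<longleftrightarrow> next_colour i j"
  | (reverse) "\<And>i j. i \<in> {1..3} \<Longrightarrow> j \<in> {1..3} \<Longrightarrow> next_colour (p i) (p j) \<longleftrightarrow> next_colour j i"
proof -
  have "p 1 \<in> {1, 2, 3}" "p 2 \<in> {1, 2, 3}" "p 3 \<in> {1, 2, 3}" "p 1 \<noteq> p 2" "p 1 \<noteq> p 3" "p 2 \<noteq> p 3"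
    using assms unfolding colours bij_betw_def inj_on_def by auto
  then have "(\<forall>i\<in>{1..3}. \<forall>j\<in>{1..3}. next_colour (p i) (p j) \<longleftrightarrow> next_colour i j) \<or>
    (\<forall>i\<in>{1..3}. \<forall>j\<in>{1..3}. next_colour (p i) (p j) \<longleftrightarrow> next_colour j i)"
    unfolding colours by (elim insertE) (simp_all add: next_colour_def)
  then show ?thesis using preserve reverse by blast
qed

text \<open>Exactly one rotation and one reflection of the triangle take \<open>i\<close> to
  \<open>j\<close>; \<open>s\<close> chooses between them.\<close>

lemma ex_permutation_next_colour:
  assumes "i \<in> {1..3}" "j \<in> {1..3::nat}"
  shows "\<exists>p. bij_betw p {1..3} {1..3::nat} \<and> p i = j \<and>
    (\<forall>x\<in>{1..3}. \<forall>y\<in>{1..3}. next_colour (p x) (p y) \<longleftrightarrow> (if s then next_colour x y else next_colour y x))"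
proof -
  let ?p = "\<lambda>a b c x::nat. if x = 1 then a else if x = 2 then b else c :: nat"
  have bij: "bij_betw (?p a b c) {1..3} {1..3}" if "{a, b, c} = {1, 2, 3}" "a \<noteq> b" "a \<noteq> c" "b \<noteq> c" for a b c
    using that unfolding bij_betw_def colours inj_on_def by auto
  have "\<exists>a b c. {a, b, c} = {1, 2, 3} \<and> a \<noteq> b \<and> a \<noteq> c \<and> b \<noteq> c \<and> ?p a b c i = j \<and>
    (\<forall>x\<in>{1..3}. \<forall>y\<in>{1..3}. next_colour (?p a b c x) (?p a b c y) \<longleftrightarrow>
      (if s then next_colour x y else next_colour y x))"
  proof -
    \<comment> \<open>The three groups are the graphs of the three rotations; the next fact lists
      those of the three reflections.\<close>
    have "(i, j) \<in> {(1,1),(2,2),(3,3)} \<or> (i, j) \<in> {(1,2),(2,3),(3,1)} \<or> (i, j) \<in> {(1,3),(2,1),(3,2)}"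
      using assms unfolding colours by auto
    moreover have "(i, j) \<in> {(1,1),(2,3),(3,2)} \<or> (i, j) \<in> {(1,2),(2,1),(3,3)} \<or> (i, j) \<in> {(1,3),(2,2),(3,1)}"
      using assms unfolding colours by auto
    ultimately show ?thesis
    proof (cases s)
      case True
      show ?thesis using \<open>_ \<or> _ \<or> (i, j) \<in> {(1,3),(2,1),(3,2)}\<close>
      proof (elim disjE)
        assume "(i, j) \<in> {(1,1),(2,2),(3,3)}"
        then show ?thesis using True
          by (intro exI[of _ 1] exI[of _ 2] exI[of _ 3]) (auto simp: colours next_colour_def)
      next
        assume "(i, j) \<in> {(1,2),(2,3),(3,1)}"
        then show ?thesis using True
          by (intro exI[of _ 2] exI[of _ 3] exI[of _ 1]) (auto simp: colours next_colour_def)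
      next
        assume "(i, j) \<in> {(1,3),(2,1),(3,2)}"
        then show ?thesis using True
          by (intro exI[of _ 3] exI[of _ 1] exI[of _ 2]) (auto simp: colours next_colour_def)
      qed
    next
      case False
      show ?thesis using \<open>_ \<or> _ \<or> (i, j) \<in> {(1,3),(2,2),(3,1)}\<close>
      proof (elim disjE)
        assume "(i, j) \<in> {(1,1),(2,3),(3,2)}"
        then show ?thesis using False
          by (intro exI[of _ 1] exI[of _ 3] exI[of _ 2]) (auto simp: colours next_colour_def)
      next
        assume "(i, j) \<in> {(1,2),(2,1),(3,3)}"
        then show ?thesis using False
          by (intro exI[of _ 2] exI[of _ 1] exI[of _ 3]) (auto simp: colours next_colour_def)
      next
        assume "(i, j) \<in> {(1,3),(2,2),(3,1)}"
        then show ?thesis using False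
          by (intro exI[of _ 3] exI[of _ 2] exI[of _ 1]) (auto simp: colours next_colour_def)
      qed
    qed
  qed
  then obtain a b c where "{a, b, c} = {1, 2, 3}" "a \<noteq> b" "a \<noteq> c" "b \<noteq> c" "?p a b c i = j \<and>
    (\<forall>x\<in>{1..3}. \<forall>y\<in>{1..3}. next_colour (?p a b c x) (?p a b c y) \<longleftrightarrow>
      (if s then next_colour x y else next_colour y x))"
    by blast
  then show ?thesis using bij by blast
qed

section \<open>Colourings up to renaming of colours\<close>

definition colour_classes :: "'a set \<Rightarrow> ('a \<Rightarrow> nat) \<Rightarrow> 'a set multiset" where
  "colour_classes V c = {# {v \<in> V. c v = i}. i \<in># mset_set {1..3} #}"

lemma colour_classes_eq_iff:
  assumes "c ` V \<subseteq> {1..3}" "d ` V \<subseteq> {1..3}"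
  shows "colour_classes V c = colour_classes V d \<longleftrightarrow>
    (\<exists>p. bij_betw p {1..3} {1..3} \<and> (\<forall>v\<in>V. d v = p (c v)))"
proof
  assume "colour_classes V c = colour_classes V d"
  then obtain p where p: "p permutes {1..3::nat}" "\<forall>i\<in>{1..3}. {v \<in> V. c v = i} = {v \<in> V. d v = p i}"
    unfolding colour_classes_def using image_mset_eq_implies_permutes[of "{1..3::nat}"] by blast
  have "d v = p (c v)" if "v \<in> V" for v
  proof -
    have "c v \<in> {1..3}" using assms that by auto
    then have "v \<in> {v \<in> V. d v = p (c v)}" using p(2) that by blast
    then show ?thesis by simp
  qed
  then show "\<exists>p. bij_betw p {1..3} {1..3} \<and> (\<forall>v\<in>V. d v = p (c v))"
    using permutes_imp_bij[OF p(1)] by blast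
next
  assume "\<exists>p. bij_betw p {1..3} {1..3} \<and> (\<forall>v\<in>V. d v = p (c v))"
  then obtain p where p: "bij_betw p {1..3} {1..3::nat}" "\<forall>v\<in>V. d v = p (c v)" by blast
  have perm: "image_mset p (mset_set {1..3}) = mset_set {1..3}"
    using p(1) by (simp add: bij_betw_def image_mset_mset_set)
  have "colour_classes V c = {# {v \<in> V. d v = p i}. i \<in># mset_set {1..3} #}"
    unfolding colour_classes_def
  proof (rule image_mset_cong)
    fix i :: nat assume "i \<in># mset_set {1..3}"
    then have "i \<in> {1..3}" by simp
    have "c v = i \<longleftrightarrow> d v = p i" if "v \<in> V" for v
    proof -
      have "c v \<in> {1..3}" using assms(1) that by blast
      then show ?thesis
        using inj_on_eq_iff[OF bij_betw_imp_inj_on[OF p(1)] _ \<open>i \<in> {1..3}\<close>] p(2) that by metis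
    qed
    then show "{v \<in> V. c v = i} = {v \<in> V. d v = p i}" by blast
  qed
  also have "\<dots> = {# {v \<in> V. d v = i}. i \<in># image_mset p (mset_set {1..3}) #}"
    by (simp add: image_mset.compositionality comp_def)
  also have "\<dots> = colour_classes V d"
    by (simp only: perm colour_classes_def)
  finally show "colour_classes V c = colour_classes V d" .
qed

lemma partition_minus_colour_classes:
  "partition_minus (colour_classes V c) v = colour_classes (V - {v}) c"
  unfolding partition_minus_def colour_classes_def
  by (auto simp: image_mset.compositionality comp_def intro!: image_mset_cong)

definition proper_colouring :: "'a set \<Rightarrow> 'a rel \<Rightarrow> ('a \<Rightarrow> nat) \<Rightarrow> bool" where
  "proper_colouring V E c \<longleftrightarrow> c ` V \<subseteq> {1..3} \<and> (\<forall>(u, v)\<in>E. c u \<noteq> c v)"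

lemma stable_partition_iff_colouring:
  assumes "parcs T \<subseteq> pverts T \<times> pverts T"
  shows "stable_partition 3 T P \<longleftrightarrow>
    (\<exists>c. proper_colouring (pverts T) (parcs T) c \<and> P = colour_classes (pverts T) c)"
proof
  assume "stable_partition 3 T P"
  then obtain W :: "nat \<Rightarrow> _" where W: "P = {# W i. i \<in># mset_set {1..3} #}"
      "\<forall>i\<in>{1..3}. independent_set T (W i)" "disjoint_family_on W {1..3}"
      "(\<Union>i\<in>{1..3}. W i) = pverts T"
    unfolding stable_partition_def by blast
  have "\<forall>v\<in>pverts T. \<exists>i. i \<in> {1..3} \<and> v \<in> W i" using W(4) by blast
  then obtain c where c: "\<And>v. v \<in> pverts T \<Longrightarrow> c v \<in> {1..3} \<and> v \<in> W (c v)" by metis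
  have class_eq: "{v \<in> pverts T. c v = i} = W i" if "i \<in> {1..3}" for i
  proof -
    have "c v = i" if "v \<in> W i" for v
      using c[of v] \<open>i \<in> {1..3}\<close> that W(3,4) unfolding disjoint_family_on_def by blast
    then show ?thesis using c W(4) that by auto
  qed
  have "P = colour_classes (pverts T) c"
    unfolding colour_classes_def W(1) by (intro image_mset_cong) (simp add: class_eq)
  moreover have "proper_colouring (pverts T) (parcs T) c"
  proof -
    have "c u \<noteq> c v" if "(u, v) \<in> parcs T" for u v
    proof -
      have "u \<in> pverts T" "v \<in> pverts T" using that assms by auto
      then show ?thesis using c[of u] c[of v] that W(2) unfolding independent_set_def by metis
    qed
    then show ?thesis using c unfolding proper_colouring_def by auto
  qed
  ultimately show "\<exists>c. proper_colouring (pverts T) (parcs T) c \<and> P = colour_classes (pverts T) c"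
    by blast
next
  assume "\<exists>c. proper_colouring (pverts T) (parcs T) c \<and> P = colour_classes (pverts T) c"
  then obtain c where c: "c ` pverts T \<subseteq> {1..3}" "\<forall>(u, v)\<in>parcs T. c u \<noteq> c v"
      "P = colour_classes (pverts T) c"
    unfolding proper_colouring_def by blast
  then show "stable_partition 3 T P"
    unfolding stable_partition_def colour_classes_def
    by (intro exI[of _ "\<lambda>i. {v \<in> pverts T. c v = i}"])
      (auto simp: independent_set_def disjoint_family_on_def image_subset_iff)
qed

section \<open>Partitions as vertex subsets\<close>

context bipartite_tree
begin

abbreviation proper :: "('a \<Rightarrow> nat) \<Rightarrow> bool" where
  "proper \<equiv> proper_colouring V E"

text \<open>
  Membership in \<open>X\<close> marks the edges whose orientation differs from that of the 2-colouring: if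
  \<open>u \<in> A\<close>, the edge \<open>uv\<close> points from \<open>u\<close> to \<open>v\<close> exactly if \<open>X\<close> does not separate \<open>u\<close> from \<open>v\<close>.
\<close>

definition encodes :: "'a set \<Rightarrow> ('a \<Rightarrow> nat) \<Rightarrow> bool" where
  "encodes X c \<longleftrightarrow> (\<forall>(u, v)\<in>E. next_colour (c u) (c v) \<longleftrightarrow> ((u \<in> X \<longleftrightarrow> v \<in> X) \<longleftrightarrow> u \<in> A))"

lemma proper_range: "proper c \<Longrightarrow> v \<in> V \<Longrightarrow> c v \<in> {1..3}"
  unfolding proper_colouring_def by blast

lemma proper_arc: "proper c \<Longrightarrow> (u, v) \<in> E \<Longrightarrow> c u \<noteq> c v"
  unfolding proper_colouring_def by blast

lemma encodes_arc:
  "encodes X c \<Longrightarrow> (u, v) \<in> E \<Longrightarrow> next_colour (c u) (c v) \<longleftrightarrow> ((u \<in> X \<longleftrightarrow> v \<in> X) \<longleftrightarrow> u \<in> A)"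
  unfolding encodes_def by blast

text \<open>Orient each edge as \<open>X\<close> prescribes and let a potential rise by 1 along it;
  the colour is the potential modulo 3. Adjacent potentials differ by 1, so they never share a
  residue.\<close>

lemma ex_encoded_colouring: "\<exists>c. proper c \<and> encodes X c"
proof -
  define g :: "'a \<Rightarrow> 'a \<Rightarrow> int" where "g u v = (if (u \<in> X \<longleftrightarrow> v \<in> X) \<longleftrightarrow> u \<in> A then 1 else - 1)" for u v
  have "g u v = - g v u" if "(u, v) \<in> E" for u v
    unfolding g_def using arc_side[OF that] by auto
  then obtain f where f: "\<And>u v. (u, v) \<in> E \<Longrightarrow> f v - f u = g u v"
    using grown_potential[OF grown, of g] by blast
  have g_eq: "g u v = 1 \<longleftrightarrow> ((u \<in> X \<longleftrightarrow> v \<in> X) \<longleftrightarrow> u \<in> A)" for u v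
    by (simp add: g_def)
  define c where "c v = nat (f v mod 3) + 1" for v
  have next_c: "next_colour (c u) (c v) \<longleftrightarrow> g u v = 1" if "(u, v) \<in> E" for u v
    unfolding c_def next_colour_mod f[OF that] by (simp add: g_def)
  have "c v \<in> {1..3}" for v
    unfolding c_def using pos_mod_bound[of 3 "f v"] pos_mod_sign[of 3 "f v"] by auto
  moreover have "c u \<noteq> c v" if "(u, v) \<in> E" for u v
  proof -
    have "(f v - f u) mod 3 \<noteq> 0" unfolding f[OF that] by (simp add: g_def)
    then have "f v mod 3 \<noteq> f u mod 3" by (metis mod_eq_dvd_iff mod_0_imp_dvd dvd_imp_mod_0)
    then show ?thesis unfolding c_def
      by (metis add_right_cancel eq_nat_nat_iff pos_mod_sign zero_less_numeral)
  qed
  ultimately have "proper c" unfolding proper_colouring_def by auto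
  moreover have "encodes X c" unfolding encodes_def using next_c g_eq by blast
  ultimately show ?thesis by blast
qed

text \<open>Edges oriented as in the 2-colouring get increment 0, the others 1 or -1, the sign only
  making \<open>g\<close> antisymmetric. Membership changes exactly across the latter, so the parity
  of the potential is the sought subset.\<close>

lemma ex_encoding:
  assumes "proper c"
  shows "\<exists>X\<subseteq>V. encodes X c"
proof -
  define g :: "'a \<Rightarrow> 'a \<Rightarrow> int" where
    "g u v = (if next_colour (c u) (c v) \<longleftrightarrow> u \<in> A then 0 else if u \<in> A then 1 else - 1)" for u v
  have "g u v = - g v u" if "(u, v) \<in> E" for u v
    unfolding g_def using arc_side[OF that] arc_in_V[OF that]
      next_colour_total[OF proper_range proper_range proper_arc, OF assms _ assms _ assms that]
    by auto
  then obtain f where f: "\<And>u v. (u, v) \<in> E \<Longrightarrow> f v - f u = g u v"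
    using grown_potential[OF grown, of g] by blast
  have "encodes {v \<in> V. odd (f v)} c"
    unfolding encodes_def
  proof (intro ballI, clarify)
    fix u v assume uv: "(u, v) \<in> E"
    have "f v = f u + g u v" using f[OF uv] by simp
    then have "(odd (f u) \<longleftrightarrow> odd (f v)) \<longleftrightarrow> even (g u v)" by auto
    moreover have "even (g u v) \<longleftrightarrow> (next_colour (c u) (c v) \<longleftrightarrow> u \<in> A)" by (auto simp: g_def)
    ultimately have "next_colour (c u) (c v) \<longleftrightarrow> ((odd (f u) \<longleftrightarrow> odd (f v)) \<longleftrightarrow> u \<in> A)" by argo
    then show "next_colour (c u) (c v) \<longleftrightarrow> ((u \<in> {v \<in> V. odd (f v)} \<longleftrightarrow> v \<in> {v \<in> V. odd (f v)}) \<longleftrightarrow> u \<in> A)"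
      by (simp only: mem_Collect_eq arc_in_V[OF uv] simp_thms)
  qed
  then show ?thesis by (intro exI[of _ "{v \<in> V. odd (f v)}"]) simp
qed

text \<open>Align the colourings at one vertex \<open>r\<close> by a triangle symmetry of the right
  kind; the orientations then force agreement along every edge. \<open>s\<close> says whether they
  are all kept or all reversed.\<close>

lemma colour_classes_eq_if_coherent:
  assumes c: "proper c" and d: "proper d"
    and "\<And>u v. (u, v) \<in> E \<Longrightarrow>
      next_colour (d u) (d v) \<longleftrightarrow> (if s then next_colour (c u) (c v) else next_colour (c v) (c u))"
  shows "colour_classes V c = colour_classes V d"
proof -
  obtain r where r: "r \<in> V" using V_nonempty by blast
  obtain p where p: "bij_betw p {1..3} {1..3::nat}" "p (c r) = d r"
      "\<And>x y. x \<in> {1..3} \<Longrightarrow> y \<in> {1..3} \<Longrightarrow>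
        next_colour (p x) (p y) \<longleftrightarrow> (if s then next_colour x y else next_colour y x)"
    using ex_permutation_next_colour[OF proper_range[OF c r] proper_range[OF d r], of s] by blast
  define S where "S = {v \<in> V. d v = p (c v)}"
  have step: "v \<in> S" if "(u, v) \<in> E" "u \<in> S" for u v
  proof -
    have V: "u \<in> V" "v \<in> V" using arc_in_V that(1) by auto
    note cr = proper_range[OF c V(1)] proper_range[OF c V(2)]
    have pr: "p (c v) \<in> {1..3}" using p(1) cr by (auto simp: bij_betw_def)
    have "p (c v) \<noteq> p (c u)"
      using inj_on_eq_iff[OF bij_betw_imp_inj_on[OF p(1)] cr(2) cr(1)] proper_arc[OF c that(1)] by metis
    moreover have "next_colour (d u) (p (c v)) \<longleftrightarrow> next_colour (d u) (d v)"
      using p(3)[OF cr] assms(3)[OF that(1)] that(2) unfolding S_def by simp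
    ultimately have "p (c v) = d v"
      using next_colour_unique[OF proper_range[OF d V(1)] pr proper_range[OF d V(2)]]
        proper_arc[OF d that(1)] that(2) unfolding S_def by auto
    then show ?thesis using V unfolding S_def by simp
  qed
  have "S = {} \<or> S = V"
  proof (rule closed_trivial)
    show "S \<subseteq> V" unfolding S_def by blast
    show "u \<in> S \<longleftrightarrow> v \<in> S" if "(u, v) \<in> E" for u v
      using step[OF that] step[OF arc_sym[OF that]] by blast
  qed
  moreover have "r \<in> S" using r p(2) unfolding S_def by simp
  ultimately have "\<forall>v\<in>V. d v = p (c v)" unfolding S_def by blast
  moreover have ranges: "c ` V \<subseteq> {1..3}" "d ` V \<subseteq> {1..3}"
    using c d unfolding proper_colouring_def by simp_all
  ultimately show ?thesis unfolding colour_classes_eq_iff[OF ranges] using p(1)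
    by (intro exI[of _ p] conjI)
qed

text \<open>A colour permutation keeps all edge orientations or reverses them all. In the first case
  membership in \<open>sym_diff X Y\<close> is constant along edges, in the second it alternates;
  connectedness leaves \<open>{}\<close> and \<open>V\<close>, respectively \<open>A\<close> and
  \<open>B\<close>.\<close>

lemma encodes_classes_eq_iff:
  assumes X: "X \<subseteq> V" and Y: "Y \<subseteq> V" and c: "proper c" "encodes X c" and d: "proper d" "encodes Y d"
  shows "colour_classes V c = colour_classes V d \<longleftrightarrow> sym_diff X Y \<in> {{}, A, B, V}"
proof
  assume "colour_classes V c = colour_classes V d"
  moreover have ranges: "c ` V \<subseteq> {1..3}" "d ` V \<subseteq> {1..3}"
    using c d unfolding proper_colouring_def by simp_all
  ultimately obtain p where p: "bij_betw p {1..3} {1..3::nat}" "\<forall>v\<in>V. d v = p (c v)"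
    unfolding colour_classes_eq_iff[OF ranges] by (elim exE conjE)
  from p(1) show "sym_diff X Y \<in> {{}, A, B, V}"
  proof (cases rule: permutation_next_colour)
    case preserve
    have "sym_diff X Y = {} \<or> sym_diff X Y = V"
    proof (rule closed_trivial)
      show "sym_diff X Y \<subseteq> V" using X Y by blast
      fix u v assume uv: "(u, v) \<in> E"
      have V: "u \<in> V" "v \<in> V" using arc_in_V uv by auto
      have "next_colour (d u) (d v) \<longleftrightarrow> next_colour (c u) (c v)"
        using preserve proper_range[OF c(1)] V p(2) by metis
      then show "u \<in> sym_diff X Y \<longleftrightarrow> v \<in> sym_diff X Y"
        using encodes_arc[OF c(2) uv] encodes_arc[OF d(2) uv] by auto
    qed
    then show ?thesis by blast
  next
    case reverse
    \<comment> \<open>An alternating set becomes constant along edges after toggling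
      \<open>A\<close>, so \<open>closed_trivial\<close> applies.\<close>
    let ?D = "sym_diff (sym_diff X Y) A"
    have "?D = {} \<or> ?D = V"
    proof (rule closed_trivial)
      show "?D \<subseteq> V" using X Y bipartition by blast
      fix u v assume uv: "(u, v) \<in> E"
      have V: "u \<in> V" "v \<in> V" using arc_in_V uv by auto
      have "next_colour (d u) (d v) \<longleftrightarrow> next_colour (c v) (c u)"
        using reverse proper_range[OF c(1)] V p(2) by metis
      then show "u \<in> ?D \<longleftrightarrow> v \<in> ?D"
        using encodes_arc[OF c(2) arc_sym[OF uv]] encodes_arc[OF d(2) uv] arc_side[OF uv] by auto
    qed
    then have "sym_diff X Y = A \<or> sym_diff X Y = B"
    proof
      assume "?D = {}"
      then have "sym_diff X Y = A" by blast
      then show ?thesis ..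
    next
      assume "?D = V"
      then have "sym_diff X Y = B" using X Y bipartition by blast
      then show ?thesis ..
    qed
    then show ?thesis by blast
  qed
next
  assume D: "sym_diff X Y \<in> {{}, A, B, V}"
  let ?s = "sym_diff X Y \<in> {{}, V}"
  show "colour_classes V c = colour_classes V d"
  proof (rule colour_classes_eq_if_coherent[OF c(1) d(1), of ?s])
    fix u v assume uv: "(u, v) \<in> E"
    have V: "u \<in> V" "v \<in> V" using arc_in_V uv by auto
    have dd: "next_colour (d u) (d v) \<longleftrightarrow> ((u \<in> Y \<longleftrightarrow> v \<in> Y) \<longleftrightarrow> u \<in> A)"
      using encodes_arc[OF d(2) uv] .
    show "next_colour (d u) (d v) \<longleftrightarrow> (if ?s then next_colour (c u) (c v) else next_colour (c v) (c u))"
    proof (cases ?s)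
      case True
      then have "u \<in> sym_diff X Y \<longleftrightarrow> v \<in> sym_diff X Y" using V by blast
      then show ?thesis using True dd encodes_arc[OF c(2) uv] by auto
    next
      case False
      then have "sym_diff X Y = A \<or> sym_diff X Y = B" using D by blast
      then have "u \<in> sym_diff X Y \<longleftrightarrow> v \<notin> sym_diff X Y"
        using arc_side[OF uv] V bipartition(1,2) by blast
      then have "(u \<in> X \<longleftrightarrow> v \<in> X) \<longleftrightarrow> \<not> (u \<in> Y \<longleftrightarrow> v \<in> Y)" by blast
      then show ?thesis using False dd encodes_arc[OF c(2) arc_sym[OF uv]] arc_side[OF uv] by auto
    qed
  qed
qed

section \<open>Recolouring a single vertex\<close>

text \<open>Two different colours are possible at \<open>v\<close>, so all its neighbours have the
  third one, and the change reverses every edge at \<open>v\<close>. Toggling \<open>v\<close> in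
  \<open>X\<close> does exactly that.\<close>

lemma recolour_encodes:
  assumes c: "proper c" "encodes X c" and d: "proper (c(v := y))" and "v \<in> V" "y \<noteq> c v"
  shows "encodes (sym_diff X {v}) (c(v := y))" and "unsplit X v"
proof -
  have yv: "y \<in> {1..3}" using proper_range[OF d \<open>v \<in> V\<close>] by simp
  have nb: "c u \<in> {1..3}" "c u \<noteq> c v" "c u \<noteq> y" "u \<noteq> v" if "(v, u) \<in> E" for u
    using proper_range[OF c(1)] arc_in_V[OF that] proper_arc[OF c(1) that] proper_arc[OF d that]
      arc_neq[OF that] by auto
  note cv = proper_range[OF c(1) \<open>v \<in> V\<close>]
  have flip: "next_colour y (c u) \<longleftrightarrow> \<not> next_colour (c v) (c u)" if "(v, u) \<in> E" for u
    using next_colour_third[OF cv yv nb(1)[OF that]] nb[OF that] assms(5) by auto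
  have flip': "next_colour (c u) y \<longleftrightarrow> \<not> next_colour (c u) (c v)" if "(v, u) \<in> E" for u
    using flip[OF that] next_colour_total[OF yv nb(1)[OF that]]
      next_colour_total[OF cv nb(1)[OF that]] nb[OF that] by auto
  show "encodes (sym_diff X {v}) (c(v := y))"
    unfolding encodes_def
  proof (intro ballI, clarify)
    fix u w assume uw: "(u, w) \<in> E"
    then have "u \<noteq> w" by (rule arc_neq)
    consider "u = v" | "w = v" | "u \<noteq> v" "w \<noteq> v" by blast
    then show "next_colour ((c(v := y)) u) ((c(v := y)) w) \<longleftrightarrow>
        ((u \<in> sym_diff X {v} \<longleftrightarrow> w \<in> sym_diff X {v}) \<longleftrightarrow> u \<in> A)"
    proof cases
      case 1
      then show ?thesis using flip[of w] uw encodes_arc[OF c(2) uw] \<open>u \<noteq> w\<close> by auto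
    next
      case 2
      then show ?thesis using flip'[of u] arc_sym[OF uw] encodes_arc[OF c(2) uw] \<open>u \<noteq> w\<close> by auto
    next
      case 3
      then show ?thesis using encodes_arc[OF c(2) uw] by auto
    qed
  qed
  show "unsplit X v"
    unfolding unsplit_def
  proof (intro allI impI)
    fix u w assume vu: "(v, u) \<in> E" and vw: "(v, w) \<in> E"
    have "c u = c w"
      using nb[OF vu] nb[OF vw] cv yv assms(5) unfolding colours by auto
    then show "u \<in> X \<longleftrightarrow> w \<in> X"
      using encodes_arc[OF c(2) vu] encodes_arc[OF c(2) vw] by auto
  qed
qed

text \<open>Neighbours lying in the same direction from \<open>c v\<close> on the triangle share a
  colour \<open>z\<close>, and some colour avoids both \<open>c v\<close> and
  \<open>z\<close>.\<close>

lemma unsplit_recolour: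
  assumes c: "proper c" "encodes X c" and "v \<in> V" "unsplit X v"
  obtains y where "y \<noteq> c v" "proper (c(v := y))"
proof -
  have same: "c u = c w" if "(v, u) \<in> E" "(v, w) \<in> E" for u w
  proof (rule next_colour_unique)
    show "c v \<in> {1..3}" "c u \<in> {1..3}" "c w \<in> {1..3}" "c u \<noteq> c v" "c w \<noteq> c v"
      using proper_range[OF c(1)] arc_in_V[OF that(1)] arc_in_V[OF that(2)] proper_arc[OF c(1) that(1)]
        proper_arc[OF c(1) that(2)] by auto
    have "u \<in> X \<longleftrightarrow> w \<in> X" using assms(4) that unfolding unsplit_def by blast
    then show "next_colour (c v) (c u) \<longleftrightarrow> next_colour (c v) (c w)"
      using encodes_arc[OF c(2) that(1)] encodes_arc[OF c(2) that(2)] by simp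
  qed
  \<comment> \<open>If \<open>v\<close> has no neighbour, \<open>z\<close> is arbitrary and need not
    be a colour; the count below allows for that.\<close>
  obtain z where z: "\<And>u. (v, u) \<in> E \<Longrightarrow> c u = z"
  proof (cases "\<exists>w. (v, w) \<in> E")
    case True
    then obtain w where "(v, w) \<in> E" by blast
    then show ?thesis using same that[of "c w"] by blast
  next
    case False
    then show ?thesis using that by blast
  qed
  have "\<exists>y\<in>{1..3}. y \<noteq> c v \<and> y \<noteq> z"
  proof -
    have "card ({1..3} - {c v, z}) \<ge> card {1..3::nat} - card {c v, z}"
      by (intro diff_card_le_card_Diff) auto
    moreover have "card {c v, z} \<le> 2" by (simp add: card_insert_if)
    moreover have "card {1..3::nat} = 3" by simp
    ultimately have "card ({1..3} - {c v, z}) \<noteq> 0" by linarith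
    then have "{1..3} - {c v, z} \<noteq> {}" by (metis card.empty)
    then show ?thesis by blast
  qed
  then obtain y where y: "y \<in> {1..3}" "y \<noteq> c v" "y \<noteq> z" by blast
  have "proper (c(v := y))"
    unfolding proper_colouring_def
  proof (intro conjI ballI, goal_cases)
    case 1
    show ?case using y(1) proper_range[OF c(1)] by auto
  next
    case (2 e)
    then obtain u w where uw: "e = (u, w)" "(u, w) \<in> E" by (cases e) auto
    then show ?case
      using proper_arc[OF c(1) uw(2)] arc_neq[OF uw(2)] z[of w] z[of u] arc_sym[OF uw(2)] y(3) by auto
  qed
  then show ?thesis using that y(2) by blast
qed

section \<open>Bell partitions indexed by vertex subsets\<close>

text \<open>For \<open>X \<subseteq> V\<close> any choice yields the same partition, by
  \<open>encodes_classes_eq_iff\<close>.\<close>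

definition colouring_of :: "'a set \<Rightarrow> 'a \<Rightarrow> nat" where
  "colouring_of X = (SOME c. proper c \<and> encodes X c)"

definition partition_of :: "'a set \<Rightarrow> 'a set multiset" where
  "partition_of X = colour_classes V (colouring_of X)"

lemma colouring_of: "proper (colouring_of X)" "encodes X (colouring_of X)"
  using someI_ex[OF ex_encoded_colouring[of X]] unfolding colouring_of_def by auto

lemma partition_of_eq_iff:
  "X \<subseteq> V \<Longrightarrow> Y \<subseteq> V \<Longrightarrow> partition_of X = partition_of Y \<longleftrightarrow> sym_diff X Y \<in> {{}, A, B, V}"
  unfolding partition_of_def
  by (rule encodes_classes_eq_iff[OF _ _ colouring_of colouring_of])

lemma partition_of_eqI:
  assumes "X \<subseteq> V" "proper c" "encodes X c"
  shows "partition_of X = colour_classes V c"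
  unfolding partition_of_def
  by (rule encodes_classes_eq_iff[OF assms(1,1) colouring_of assms(2,3), THEN iffD2]) simp

text \<open>Agreement after deleting \<open>v\<close> means that one colouring turns into the other,
  up to renaming colours, by recolouring \<open>v\<close> alone.\<close>

lemma partition_of_adjacent_iff:
  assumes "X \<subseteq> V" "Y \<subseteq> V"
  shows "partition_of X \<noteq> partition_of Y \<and>
      (\<exists>v\<in>V. partition_minus (partition_of X) v = partition_minus (partition_of Y) v) \<longleftrightarrow>
    partition_of X \<noteq> partition_of Y \<and>
      (\<exists>v\<in>V. unsplit X v \<and> partition_of Y = partition_of (sym_diff X {v}))"
proof -
  define c d where "c = colouring_of X" and "d = colouring_of Y"
  have c: "proper c" "encodes X c" and d: "proper d" "encodes Y d"
    unfolding c_def d_def using colouring_of by auto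
  have cX: "partition_of X = colour_classes V c" and dY: "partition_of Y = colour_classes V d"
    unfolding partition_of_def c_def d_def by auto
  have ranges: "c ` (V - {v}) \<subseteq> {1..3}" "d ` (V - {v}) \<subseteq> {1..3}" for v
    using c(1) d(1) unfolding proper_colouring_def by auto
  show ?thesis
  proof (rule conj_cong[OF refl], intro iffI; elim bexE)
    fix v
    assume ne: "partition_of X \<noteq> partition_of Y" and "v \<in> V"
      and "partition_minus (partition_of X) v = partition_minus (partition_of Y) v"
    then have "colour_classes (V - {v}) c = colour_classes (V - {v}) d"
      unfolding cX dY partition_minus_colour_classes by simp
    then obtain p where p: "bij_betw p {1..3} {1..3::nat}" "\<forall>u\<in>V - {v}. d u = p (c u)"
      unfolding colour_classes_eq_iff[OF ranges] by blast
    have "d v \<in> p ` {1..3}"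
      using p(1) proper_range[OF d(1) \<open>v \<in> V\<close>] unfolding bij_betw_def by blast
    \<comment> \<open>The renaming \<open>p\<close> is known to match \<open>c\<close> with
      \<open>d\<close> only away from \<open>v\<close>. Giving \<open>v\<close> the colour
      \<open>y\<close> that \<open>p\<close> sends to \<open>d v\<close> extends the match to all of
      \<open>V\<close>.\<close>
    then obtain y where y: "y \<in> {1..3}" "d v = p y" by blast
    let ?e = "c(v := y)"
    have de: "d u = p (?e u)" if "u \<in> V" for u using p(2) y(2) that by auto
    have er: "?e ` V \<subseteq> {1..3}" using y(1) proper_range[OF c(1)] by auto
    have "proper ?e"
      unfolding proper_colouring_def
    proof (intro conjI er ballI, clarify)
      fix u w assume uw: "(u, w) \<in> E" "?e u = ?e w"
      then have "d u = d w" using de arc_in_V[OF uw(1)] by metis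
      then show False using proper_arc[OF d(1) uw(1)] by blast
    qed
    have "d ` V \<subseteq> {1..3}" using proper_range[OF d(1)] by blast
    have "colour_classes V ?e = colour_classes V d"
      unfolding colour_classes_eq_iff[OF er \<open>d ` V \<subseteq> {1..3}\<close>] using p(1) de by blast
    then have "y \<noteq> c v" using ne cX dY by auto
    note re = recolour_encodes[OF c \<open>proper ?e\<close> \<open>v \<in> V\<close> this]
    have "partition_of (sym_diff X {v}) = colour_classes V ?e"
      using assms \<open>v \<in> V\<close> \<open>proper ?e\<close> re(1) by (intro partition_of_eqI) auto
    then show "\<exists>v\<in>V. unsplit X v \<and> partition_of Y = partition_of (sym_diff X {v})"
      using re(2) \<open>v \<in> V\<close> \<open>colour_classes V ?e = _\<close> dY by auto
  next
    fix v
    assume v: "v \<in> V" and "unsplit X v \<and> partition_of Y = partition_of (sym_diff X {v})"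
    then have us: "unsplit X v" and Y: "partition_of Y = partition_of (sym_diff X {v})" by auto
    obtain y where y: "y \<noteq> c v" "proper (c(v := y))"
      using unsplit_recolour[OF c v us] .
    have "partition_of (sym_diff X {v}) = colour_classes V (c(v := y))"
      using assms v y(2) recolour_encodes(1)[OF c y(2) v y(1)] by (intro partition_of_eqI) auto
    then have "partition_minus (partition_of Y) v = colour_classes (V - {v}) (c(v := y))"
      unfolding Y by (simp add: partition_minus_colour_classes)
    also have "\<dots> = colour_classes (V - {v}) c"
      unfolding colour_classes_def by (intro image_mset_cong) auto
    also have "\<dots> = partition_minus (partition_of X) v"
      unfolding cX partition_minus_colour_classes ..
    finally show "\<exists>v\<in>V. partition_minus (partition_of X) v = partition_minus (partition_of Y) v"
      using v by metis
  qed
qed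

lemma partition_of_image:
  assumes "V = pverts T" "E = parcs T"
  shows "partition_of ` Pow V = {P. stable_partition 3 T P}"
proof -
  have sp: "stable_partition 3 T P \<longleftrightarrow> (\<exists>c. proper c \<and> P = colour_classes V c)" for P
    using stable_partition_iff_colouring[of T P] grown_arcs[OF grown] assms by simp
  show ?thesis
  proof (intro equalityI subsetI)
    fix P assume "P \<in> partition_of ` Pow V"
    then show "P \<in> {P. stable_partition 3 T P}"
      using colouring_of(1) sp unfolding partition_of_def by blast
  next
    fix P assume "P \<in> {P. stable_partition 3 T P}"
    then obtain c where c: "proper c" "P = colour_classes V c" using sp by blast
    obtain X where X: "X \<subseteq> V" "encodes X c" using ex_encoding[OF c(1)] by blast
    then have "P = partition_of X" using partition_of_eqI[OF X(1) c(1) X(2)] c(2) by simp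
    then show "P \<in> partition_of ` Pow V" using X by blast
  qed
qed

end

text \<open>
  \<open>(HV, HE)\<close> is the Bell 3-colouring graph presented as a quotient of the power set of \<open>V\<close>; \<open>\<pi>\<close> is
  the quotient map.
\<close>

locale tree_model = bipartite_tree V E A B
  for V :: "'a set" and E A B +
  fixes HV :: "'b set" and HE :: "'b rel" and \<pi> :: "'a set \<Rightarrow> 'b"
  assumes \<pi>_image: "\<pi> ` Pow V = HV"
    and \<pi>_eq_iff: "X \<subseteq> V \<Longrightarrow> Y \<subseteq> V \<Longrightarrow> \<pi> X = \<pi> Y \<longleftrightarrow> sym_diff X Y \<in> {{}, A, B, V}"
    and HE_subset: "HE \<subseteq> HV \<times> HV"
    and HE_iff: "X \<subseteq> V \<Longrightarrow> Y \<subseteq> V \<Longrightarrow> (\<pi> X, \<pi> Y) \<in> HE \<longleftrightarrow>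
      \<pi> X \<noteq> \<pi> Y \<and> (\<exists>v\<in>V. unsplit X v \<and> \<pi> Y = \<pi> (sym_diff X {v}))"

lemma undirected_tree_model:
  assumes "undirected_tree T"
  shows "\<exists>A B \<pi>. tree_model (pverts T) (parcs T) A B (pverts (bell_graph 3 T)) (parcs (bell_graph 3 T)) \<pi>"
proof -
  have g: "grown (pverts T) (parcs T)" using assms by (rule undirected_tree_imp_grown)
  then obtain A B where AB: "pverts T = A \<union> B" "A \<inter> B = {}" "parcs T \<subseteq> A \<times> B \<union> B \<times> A"
    using grown_bipartition[OF g] by blast
  interpret bipartite_tree "pverts T" "parcs T" A B
    using g AB by unfold_locales
  have img: "partition_of ` Pow (pverts T) = {P. stable_partition 3 T P}"
    by (rule partition_of_image) auto
  have "tree_model (pverts T) (parcs T) A B (pverts (bell_graph 3 T)) (parcs (bell_graph 3 T)) partition_of"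
  proof unfold_locales
    show "partition_of ` Pow (pverts T) = pverts (bell_graph 3 T)"
      using img by (simp add: bell_graph_def)
    show "parcs (bell_graph 3 T) \<subseteq> pverts (bell_graph 3 T) \<times> pverts (bell_graph 3 T)"
      by (auto simp: bell_graph_def)
    fix X Y assume XY: "X \<subseteq> pverts T" "Y \<subseteq> pverts T"
    show "partition_of X = partition_of Y \<longleftrightarrow> sym_diff X Y \<in> {{}, A, B, pverts T}"
      by (rule partition_of_eq_iff[OF XY])
    have "stable_partition 3 T (partition_of X)" "stable_partition 3 T (partition_of Y)"
      using img XY by blast+
    then show "(partition_of X, partition_of Y) \<in> parcs (bell_graph 3 T) \<longleftrightarrow>
      partition_of X \<noteq> partition_of Y \<and>
        (\<exists>v\<in>pverts T. unsplit X v \<and> partition_of Y = partition_of (sym_diff X {v}))"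
      unfolding partition_of_adjacent_iff[OF XY, symmetric] by (simp add: bell_graph_def)
  qed
  then show ?thesis by blast
qed

section \<open>Degrees in the Bell graph\<close>

context bipartite_tree
begin

lemma unsplit_iff: "unsplit X v \<longleftrightarrow> E `` {v} \<inter> X = {} \<or> E `` {v} \<subseteq> X"
  unfolding unsplit_def by blast

lemma neighbours_A: "a \<in> A \<Longrightarrow> E `` {a} \<subseteq> B" and neighbours_B: "b \<in> B \<Longrightarrow> E `` {b} \<subseteq> A"
  using bipartition by blast+

lemma card_V: "card V = card A + card B"
  using bipartition(1,2) finite_A finite_B by (simp add: card_Un_disjoint)

lemma neighbours_nonempty:
  assumes "2 \<le> card V" "v \<in> V"
  shows "E `` {v} \<noteq> {}"
proof
  assume "E `` {v} = {}"
  then have "{v} = {} \<or> {v} = V"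
    using assms(2) arc_sym by (intro closed_trivial) auto
  then show False using assms(1) by auto
qed

lemma sides_nonempty:
  assumes "2 \<le> card V"
  shows "A \<noteq> {}" "B \<noteq> {}"
proof -
  obtain v where v: "v \<in> V" using V_nonempty by blast
  then obtain w where "(v, w) \<in> E" using neighbours_nonempty[OF assms v] by blast
  then show "A \<noteq> {}" "B \<noteq> {}" using bipartition(3) by blast+
qed

text \<open>At an unsplit vertex, \<open>X\<close> separates either none or all of its edges.
  Adjacent vertices share an edge, so one alternative holds on the whole tree: the first gives
  \<open>{}\<close> or \<open>V\<close>, the second \<open>A\<close> or \<open>B\<close>.\<close>

lemma all_unsplit_trivial:
  assumes "X \<subseteq> V" "\<And>v. v \<in> V \<Longrightarrow> unsplit X v"
  shows "X \<in> {{}, A, B, V}"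
proof -
  \<comment> \<open>The vertices for which no incident edge is separated by
    \<open>X\<close>.\<close>
  define S where "S = {u \<in> V. \<forall>w. (u, w) \<in> E \<longrightarrow> (u \<in> X \<longleftrightarrow> w \<in> X)}"
  have step: "w \<in> S" if "(u, w) \<in> E" "u \<in> S" for u w
  proof -
    have "unsplit X w" "w \<in> V" using assms(2) arc_in_V[OF that(1)] by auto
    moreover have "u \<in> X \<longleftrightarrow> w \<in> X" using that unfolding S_def by blast
    ultimately show ?thesis using arc_sym[OF that(1)] unfolding S_def unsplit_def by blast
  qed
  have "S = {} \<or> S = V"
  proof (rule closed_trivial)
    show "S \<subseteq> V" unfolding S_def by blast
    show "u \<in> S \<longleftrightarrow> w \<in> S" if "(u, w) \<in> E" for u w
      using step[OF that] step[OF arc_sym[OF that]] by blast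
  qed
  then show ?thesis
  proof
    assume "S = V"
    then have "X = {} \<or> X = V"
      using arc_in_V unfolding S_def by (intro closed_trivial assms(1)) blast
    then show ?thesis by blast
  next
    assume "S = {}"
    have disagree: "u \<in> X \<longleftrightarrow> w \<notin> X" if "(u, w) \<in> E" for u w
    proof -
      have "u \<in> V" using arc_in_V[OF that] by simp
      then obtain x where "(u, x) \<in> E" "(u \<in> X) \<noteq> (x \<in> X)"
        using \<open>S = {}\<close> unfolding S_def by blast
      then show ?thesis using assms(2)[OF \<open>u \<in> V\<close>] that unfolding unsplit_def by blast
    qed
    have "sym_diff X A = {} \<or> sym_diff X A = V"
    proof (rule closed_trivial)
      show "sym_diff X A \<subseteq> V" using assms(1) bipartition(1) by blast
      show "u \<in> sym_diff X A \<longleftrightarrow> w \<in> sym_diff X A" if "(u, w) \<in> E" for u w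
        using disagree[OF that] arc_side[OF that] by blast
    qed
    then have "X = A \<or> X = B" using assms(1) bipartition(1,2) by blast
    then show ?thesis by blast
  qed
qed

end

context tree_model
begin

text \<open>Symmetry between the sides, so that \<open>A\<close> can later be taken as the smaller
  one.\<close>

lemma swap_model: "tree_model V E B A HV HE \<pi>"
proof -
  interpret S: bipartite_tree V E B A by (rule swap)
  show ?thesis
  proof unfold_locales
    fix X Y assume XY: "X \<subseteq> V" "Y \<subseteq> V"
    have "{{}, B, A, V} = {{}, A, B, V}" by blast
    then show "\<pi> X = \<pi> Y \<longleftrightarrow> sym_diff X Y \<in> {{}, B, A, V}"
      by (simp only: \<pi>_eq_iff[OF XY])
    show "(\<pi> X, \<pi> Y) \<in> HE \<longleftrightarrow>
        \<pi> X \<noteq> \<pi> Y \<and> (\<exists>v\<in>V. unsplit X v \<and> \<pi> Y = \<pi> (sym_diff X {v}))"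
      by (rule HE_iff[OF XY])
  qed (rule \<pi>_image HE_subset)+
qed

lemma finite_HV: "finite HV"
  using \<pi>_image finite_V by (metis finite_Pow_iff finite_imageI)

lemma finite_neighbours: "finite (HE `` {x})"
  using HE_subset finite_HV by (auto intro: finite_subset[of _ HV])

text \<open>Removing \<open>\<pi> X\<close> discards the toggle of a vertex that forms a side on its
  own, which does not change the class.\<close>

lemma neighbours_\<pi>:
  assumes "X \<subseteq> V"
  shows "HE `` {\<pi> X} = (\<lambda>v. \<pi> (sym_diff X {v})) ` {v \<in> V. unsplit X v} - {\<pi> X}"
proof (intro equalityI subsetI)
  fix y assume y: "y \<in> HE `` {\<pi> X}"
  then have "y \<in> HV" using HE_subset by blast
  then obtain Y where Y: "Y \<subseteq> V" "y = \<pi> Y" using \<pi>_image by blast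
  then show "y \<in> (\<lambda>v. \<pi> (sym_diff X {v})) ` {v \<in> V. unsplit X v} - {\<pi> X}"
    using y HE_iff[OF assms Y(1)] by auto
next
  fix y assume "y \<in> (\<lambda>v. \<pi> (sym_diff X {v})) ` {v \<in> V. unsplit X v} - {\<pi> X}"
  then obtain v where v: "v \<in> V" "unsplit X v" "y = \<pi> (sym_diff X {v})" "y \<noteq> \<pi> X" by blast
  have "sym_diff X {v} \<subseteq> V" using assms v(1) by blast
  then show "y \<in> HE `` {\<pi> X}" using HE_iff[OF assms, of "sym_diff X {v}"] v by auto
qed

lemma toggle_eq_self_iff:
  assumes "X \<subseteq> V" "v \<in> V"
  shows "\<pi> (sym_diff X {v}) = \<pi> X \<longleftrightarrow> {v} \<in> {A, B, V}"
proof -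
  have "sym_diff (sym_diff X {v}) X = {v}" by blast
  moreover have "sym_diff X {v} \<subseteq> V" using assms by blast
  ultimately show ?thesis using \<pi>_eq_iff[of "sym_diff X {v}" X] assms by auto
qed

lemma toggle_eq_iff:
  assumes "X \<subseteq> V" "v \<in> V" "w \<in> V" "v \<noteq> w"
  shows "\<pi> (sym_diff X {v}) = \<pi> (sym_diff X {w}) \<longleftrightarrow> {v, w} \<in> {A, B, V}"
proof -
  have "sym_diff (sym_diff X {v}) (sym_diff X {w}) = {v, w}" using assms(4) by blast
  moreover have "sym_diff X {v} \<subseteq> V" "sym_diff X {w} \<subseteq> V" using assms by blast+
  ultimately show ?thesis using \<pi>_eq_iff[of "sym_diff X {v}" "sym_diff X {w}"] by auto
qed

text \<open>A degree counts distinct classes among the toggles, and some toggles are trivial or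
  repeat another. Here such repetitions are absorbed by \<open>W\<close>; \<open>degree_ge\<close>
  rules them out by keeping singletons and pairs different from \<open>A\<close>, \<open>B\<close>
  and \<open>V\<close>.\<close>

lemma degree_le:
  assumes "X \<subseteq> V" "finite W"
    and "\<And>v. v \<in> V \<Longrightarrow> unsplit X v \<Longrightarrow>
      v \<in> W \<or> \<pi> (sym_diff X {v}) = \<pi> X \<or> (\<exists>w\<in>W. \<pi> (sym_diff X {v}) = \<pi> (sym_diff X {w}))"
  shows "card (HE `` {\<pi> X}) \<le> card W"
proof -
  have "HE `` {\<pi> X} \<subseteq> (\<lambda>v. \<pi> (sym_diff X {v})) ` W"
    unfolding neighbours_\<pi>[OF assms(1)] using assms(3) by blast
  then show ?thesis using assms(2) by (meson card_image_le card_mono finite_imageI le_trans)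
qed

lemma degree_ge:
  assumes "X \<subseteq> V" "W \<subseteq> V"
    and "\<And>v. v \<in> W \<Longrightarrow> unsplit X v" "\<And>v. v \<in> W \<Longrightarrow> {v} \<notin> {A, B, V}"
    and "\<And>v w. v \<in> W \<Longrightarrow> w \<in> W \<Longrightarrow> v \<noteq> w \<Longrightarrow> {v, w} \<notin> {A, B, V}"
  shows "card W \<le> card (HE `` {\<pi> X})"
proof -
  let ?f = "\<lambda>v. \<pi> (sym_diff X {v})"
  have inj: "inj_on ?f W"
  proof (rule inj_onI)
    fix v w assume vw: "v \<in> W" "w \<in> W" "?f v = ?f w"
    show "v = w"
    proof (rule ccontr)
      assume "v \<noteq> w"
      moreover have "v \<in> V" "w \<in> V" using vw assms(2) by auto
      ultimately show False using toggle_eq_iff[OF assms(1)] vw assms(5) by metis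
    qed
  qed
  have "?f ` W \<subseteq> HE `` {\<pi> X}"
  proof
    fix y assume "y \<in> ?f ` W"
    then obtain v where v: "v \<in> W" "y = ?f v" by blast
    have "v \<in> V" using assms(2) v(1) by blast
    have "y \<noteq> \<pi> X" unfolding v(2) toggle_eq_self_iff[OF assms(1) \<open>v \<in> V\<close>] by (rule assms(4)[OF v(1)])
    then show "y \<in> HE `` {\<pi> X}"
      unfolding neighbours_\<pi>[OF assms(1)] using v assms(2,3) by blast
  qed
  then show ?thesis using card_inj_on_le[OF inj _ finite_neighbours] by blast
qed

section \<open>Counting through the quotient map\<close>

text \<open>Each fibre of \<open>\<pi>\<close> is a coset of the group \<open>{{}, A, B, V}\<close>
  under symmetric difference, of order four because both sides are nonempty. The predicate
  \<open>Q\<close> lets the same count serve vertices of prescribed degree.\<close>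

lemma card_fibres:
  assumes "2 \<le> card V"
  shows "card {X \<in> Pow V. Q (\<pi> X)} = 4 * card {x \<in> HV. Q x}"
proof -
  let ?F = "\<lambda>x. {X \<in> Pow V. \<pi> X = x}"
  note ne = sides_nonempty[OF assms]
  have distinct: "card {{}, A, B, V} = 4"
  proof -
    have "{} \<notin> {A, B, V}" "A \<notin> {B, V}" "B \<noteq> V" using ne bipartition(1,2) by auto
    then have "card {{}, A, B, V} = Suc (Suc (Suc (card {V})))"
      by (simp only: card_insert_disjoint finite.intros singleton_iff not_False_eq_True)
    then show ?thesis by simp
  qed
  have fibre: "card (?F x) = 4" if x: "x \<in> HV" for x
  proof -
    obtain X where X: "X \<subseteq> V" "x = \<pi> X" using x \<pi>_image by blast
    have "?F x = (\<lambda>D. sym_diff X D) ` {{}, A, B, V}"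
    proof (intro equalityI subsetI)
      fix Y assume "Y \<in> ?F x"
      then have Y: "Y \<subseteq> V" "\<pi> X = \<pi> Y" using X by auto
      then have D: "sym_diff X Y \<in> {{}, A, B, V}" using \<pi>_eq_iff X by blast
      show "Y \<in> (\<lambda>D. sym_diff X D) ` {{}, A, B, V}"
        by (rule image_eqI[OF _ D]) (simp only: sym_diff_cancel)
    next
      fix Y assume "Y \<in> (\<lambda>D. sym_diff X D) ` {{}, A, B, V}"
      then obtain D where D: "D \<in> {{}, A, B, V}" "Y = sym_diff X D" by (rule imageE) blast
      then have "Y \<subseteq> V" using X bipartition(1) by blast
      moreover have "\<pi> X = \<pi> Y"
        using \<pi>_eq_iff[OF X(1) \<open>Y \<subseteq> V\<close>] D sym_diff_cancel[of X D] by metis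
      ultimately show "Y \<in> ?F x" using X(2) by simp
    qed
    moreover have "inj_on (\<lambda>D. sym_diff X D) {{}, A, B, V}"
      by (rule inj_on_inverseI[of _ "\<lambda>D. sym_diff X D"]) (rule sym_diff_cancel)
    ultimately show ?thesis using distinct by (simp only: card_image)
  qed
  have "{X \<in> Pow V. Q (\<pi> X)} = (\<Union>x\<in>{x \<in> HV. Q x}. ?F x)"
    using \<pi>_image by blast
  also have "card \<dots> = (\<Sum>x\<in>{x \<in> HV. Q x}. card (?F x))"
    using finite_HV finite_V by (intro card_UN_disjoint) auto
  also have "\<dots> = (\<Sum>x\<in>{x \<in> HV. Q x}. 4)" by (rule sum.cong[OF refl], rule fibre) blast
  finally show ?thesis by simp
qed

lemma card_HV: "2 \<le> card V \<Longrightarrow> 4 * card HV = 2 ^ card V"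
  using card_fibres[of "\<lambda>_. True"] card_Pow[OF finite_V] by (simp add: Pow_def)

lemma card_HV_single:
  assumes "card V = 1"
  shows "card HV = 1"
proof -
  obtain r where r: "V = {r}" using assms card_1_singletonE by blast
  have const: "\<pi> X = \<pi> {}" if "X \<subseteq> V" for X
    unfolding \<pi>_eq_iff[OF that empty_subsetI] using that r by auto
  have "\<pi> ` Pow V = (\<lambda>_. \<pi> {}) ` Pow V"
    by (rule image_cong[OF refl], rule const) simp
  then have "HV = {\<pi> {}}" unfolding \<pi>_image by auto
  then show ?thesis by simp
qed

section \<open>Stars\<close>

text \<open>Toggling the centre toggles all of \<open>A\<close> and leaves the class unchanged, so
  only leaves contribute.\<close>

lemma star_degree_le:
  assumes "card A = 1" "x \<in> HV"
  shows "card (HE `` {x}) \<le> card V - 1"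
proof -
  obtain a where a: "A = {a}" using assms(1) card_1_singletonE by blast
  obtain X where X: "X \<subseteq> V" "x = \<pi> X" using assms(2) \<pi>_image by blast
  have "card (HE `` {\<pi> X}) \<le> card B"
  proof (rule degree_le[OF X(1) finite_B])
    fix v assume "v \<in> V"
    then show "v \<in> B \<or> \<pi> (sym_diff X {v}) = \<pi> X \<or> (\<exists>w\<in>B. \<pi> (sym_diff X {v}) = \<pi> (sym_diff X {w}))"
      using toggle_eq_self_iff[OF X(1), of v] a bipartition(1) by blast
  qed
  then show ?thesis using X(2) card_V assms(1) by simp
qed

text \<open>A leaf has a single neighbour and is always unsplit. Four vertices mean at least three
  leaves, so two leaves never make up \<open>B\<close> and distinct leaves give distinct
  neighbours.\<close>

lemma star_degree_ge:
  assumes "card A = 1" "4 \<le> card V" "x \<in> HV"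
  shows "card V - 1 \<le> card (HE `` {x})"
proof -
  obtain a where a: "A = {a}" using assms(1) card_1_singletonE by blast
  obtain X where X: "X \<subseteq> V" "x = \<pi> X" using assms(3) \<pi>_image by blast
  have cB: "card B \<ge> 3" using assms(1,2) card_V by simp
  have "card B \<le> card (HE `` {\<pi> X})"
  proof (rule degree_ge[OF X(1)])
    show "B \<subseteq> V" using bipartition(1) by blast
    show "unsplit X v" if "v \<in> B" for v
      using neighbours_B[OF that] a unfolding unsplit_iff by blast
    show "{v} \<notin> {A, B, V}" if "v \<in> B" for v
      using that bipartition(2) cB assms(2) a by auto
    show "{v, w} \<notin> {A, B, V}" if "v \<in> B" "w \<in> B" "v \<noteq> w" for v w
    proof -
      have "card {v, w} = 2" using that by simp
      then show ?thesis using assms(1,2) cB by auto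
    qed
  qed
  then show ?thesis using X(2) card_V assms(1) by simp
qed

section \<open>Trees with a side of two vertices\<close>

text \<open>The tree has \<open>card B + 1\<close> edges, each with one end in \<open>A\<close>, and
  the two neighbourhoods cover \<open>B\<close>; hence they overlap in exactly one vertex.\<close>

lemma two_neighbourhoods:
  assumes "A = {a, a'}" "a \<noteq> a'" "B \<noteq> {}"
  obtains c where "E `` {a} \<union> E `` {a'} = B" "E `` {a} \<inter> E `` {a'} = {c}"
proof -
  let ?N = "E `` {a}" and ?N' = "E `` {a'}"
  have sub: "?N \<subseteq> B" "?N' \<subseteq> B" using neighbours_A assms(1) by auto
  have fin: "finite ?N" "finite ?N'" using sub finite_B finite_subset by blast+
  have cV: "card V = 2 + card B" using card_V assms(1,2) by simp
  have cover: "?N \<union> ?N' = B"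
  proof (intro equalityI subsetI)
    fix b assume b: "b \<in> B"
    then have "E `` {b} \<noteq> {}" using neighbours_nonempty[of b] cV bipartition(1) by auto
    then obtain x where "(b, x) \<in> E" by blast
    then show "b \<in> ?N \<union> ?N'" using neighbours_B[OF b] assms(1) arc_sym[of b x] by blast
  qed (use sub in blast)
  have disj: "A \<inter> B = {}" by (fact bipartition)
  have E: "E = ({a} \<times> ?N \<union> {a'} \<times> ?N') \<union> (?N \<times> {a} \<union> ?N' \<times> {a'})" (is "_ = ?P \<union> ?Q")
    using bipartition(3) assms(1) arc_sym by auto
  have P: "card ?P = card ?N + card ?N'"
    using fin assms(2) by (subst card_Un_disjoint) (auto simp: card_cartesian_product)
  have Q: "card ?Q = card ?N + card ?N'"
    using fin assms(2) by (subst card_Un_disjoint) (auto simp: card_cartesian_product)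
  have "?P \<inter> ?Q = {}" using sub disj assms(1) by auto
  moreover have "finite ?P" "finite ?Q" using fin by auto
  ultimately have "card (?P \<union> ?Q) = card ?P + card ?Q" by (simp only: card_Un_disjoint)
  then have "card E = 2 * (card ?N + card ?N')" using E P Q by simp
  then have "card ?N + card ?N' = card B + 1"
    using grown_card_arcs[OF grown] cV by simp
  then have "card (?N \<inter> ?N') = 1"
    using card_Un_Int[OF fin] cover by simp
  then obtain c where "?N \<inter> ?N' = {c}" using card_1_singletonE by blast
  then show thesis using that cover by blast
qed

context
  fixes a a' c
  assumes A_eq: "A = {a, a'}" and a_neq: "a \<noteq> a'"
    and cover: "E `` {a} \<union> E `` {a'} = B" and common: "E `` {a} \<inter> E `` {a'} = {c}"
begin

lemma c_in_B: "c \<in> B"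
  using cover common by blast

lemma two_card_V: "card V = card B + 2"
  using card_V A_eq a_neq by simp

lemma toggle_a_a': "X \<subseteq> V \<Longrightarrow> \<pi> (sym_diff X {a'}) = \<pi> (sym_diff X {a})"
  using toggle_eq_iff[of X a' a] A_eq a_neq bipartition(1) by auto

lemma two_unsplit_leaf:
  assumes "b \<in> B" "b \<noteq> c"
  shows "unsplit X b"
proof -
  have "a \<notin> E `` {b} \<or> a' \<notin> E `` {b}" using assms(2) common arc_sym by blast
  then have "E `` {b} \<subseteq> {a} \<or> E `` {b} \<subseteq> {a'}" using neighbours_B[OF assms(1)] A_eq by blast
  then show ?thesis unfolding unsplit_def by blast
qed

lemma two_unsplit_centre: "unsplit X c \<longleftrightarrow> (a \<in> X \<longleftrightarrow> a' \<in> X)"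
proof -
  have N: "E `` {c} = {a, a'}"
    using neighbours_B[OF c_in_B] A_eq common arc_sym by blast
  show ?thesis unfolding unsplit_iff N by auto
qed

text \<open>Toggling \<open>a\<close> or \<open>a'\<close> gives the same class, the difference
  being the side \<open>A\<close>; so \<open>B\<close> and one of the two account for all
  neighbours.\<close>

lemma two_degree_le:
  assumes "X \<subseteq> V"
  shows "card (HE `` {\<pi> X}) \<le> card V - 1"
proof -
  have "a \<notin> B" using A_eq bipartition(2) by blast
  moreover have "card (HE `` {\<pi> X}) \<le> card (insert a B)"
    using finite_B A_eq bipartition(1) toggle_a_a'[OF assms] by (intro degree_le[OF assms]) auto
  ultimately show ?thesis using finite_B two_card_V by simp
qed

text \<open>When \<open>X\<close> separates \<open>a\<close> from \<open>a'\<close>, their common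
  neighbour \<open>c\<close> cannot be toggled, which costs one more.\<close>

lemma two_degree_le_split:
  assumes "X \<subseteq> V" "a \<in> X \<longleftrightarrow> a' \<notin> X"
  shows "card (HE `` {\<pi> X}) \<le> card V - 2"
proof -
  have "\<not> unsplit X c" using two_unsplit_centre assms(2) by blast
  then have "card (HE `` {\<pi> X}) \<le> card (insert a (B - {c}))"
    using finite_B A_eq bipartition(1) toggle_a_a'[OF assms(1)]
    by (intro degree_le[OF assms(1)]) auto
  also have "\<dots> \<le> Suc (card (B - {c}))" using finite_B by (simp add: card_insert_if)
  also have "\<dots> = card B" by (rule card_Suc_Diff1[OF finite_B c_in_B])
  finally show ?thesis using two_card_V by simp
qed

lemma two_degree_le_blocked:
  assumes "X \<subseteq> V" "\<not> unsplit X a" "\<not> unsplit X a'"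
  shows "card (HE `` {\<pi> X}) \<le> card V - 2"
proof -
  have "card (HE `` {\<pi> X}) \<le> card B"
    using assms(2,3) A_eq bipartition(1) by (intro degree_le[OF assms(1) finite_B]) blast
  then show ?thesis using two_card_V by simp
qed

text \<open>\<open>3 \<le> card B\<close> prevents two vertices of \<open>B\<close> from being the
  whole side, and a pair meeting both sides is neither of them.\<close>

lemma two_degree_ge:
  assumes "X \<subseteq> V" "a \<in> X \<longleftrightarrow> a' \<in> X" "\<alpha> \<in> A" "unsplit X \<alpha>" "3 \<le> card B"
  shows "card V - 1 \<le> card (HE `` {\<pi> X})"
proof -
  have "\<alpha> \<notin> B" using assms(3) bipartition(2) by blast
  have cA: "card A = 2" using A_eq a_neq by simp
  have "card (insert \<alpha> B) \<le> card (HE `` {\<pi> X})"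
  proof (rule degree_ge[OF assms(1)])
    show "insert \<alpha> B \<subseteq> V" using assms(3) bipartition(1) by blast
    show "unsplit X v" if "v \<in> insert \<alpha> B" for v
      using that assms(2,4) two_unsplit_leaf two_unsplit_centre by blast
    show "{v} \<notin> {A, B, V}" if "v \<in> insert \<alpha> B" for v
      using cA assms(5) two_card_V by auto
    show "{v, w} \<notin> {A, B, V}" if "v \<in> insert \<alpha> B" "w \<in> insert \<alpha> B" "v \<noteq> w" for v w
    proof -
      have "card {v, w} = 2" using that by simp
      moreover have "{v, w} \<noteq> A"
        using that assms(3) bipartition(2) A_eq a_neq by blast
      ultimately show ?thesis using assms(5) two_card_V by auto
    qed
  qed
  then show ?thesis using two_card_V finite_B \<open>\<alpha> \<notin> B\<close> by simp
qed

text \<open>As \<open>card V - 1\<close> is also the bound of \<open>two_degree_le\<close>, this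
  characterises the vertices of maximal degree.\<close>

lemma two_degree_iff:
  assumes "X \<subseteq> V" "3 \<le> card B"
  shows "card V - 1 \<le> card (HE `` {\<pi> X}) \<longleftrightarrow>
    (a \<in> X \<longleftrightarrow> a' \<in> X) \<and> (unsplit X a \<or> unsplit X a')"
proof -
  have lt: "card V - 2 < card V - 1" using two_card_V by simp
  have A: "a \<in> A" "a' \<in> A" using A_eq by auto
  show ?thesis
  proof
    assume le: "card V - 1 \<le> card (HE `` {\<pi> X})"
    have "a \<in> X \<longleftrightarrow> a' \<in> X"
    proof (rule ccontr)
      assume "\<not> (a \<in> X \<longleftrightarrow> a' \<in> X)"
      then have "a \<in> X \<longleftrightarrow> a' \<notin> X" by simp
      then show False using two_degree_le_split[OF assms(1)] le lt by linarith
    qed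
    moreover have "unsplit X a \<or> unsplit X a'"
    proof (rule ccontr)
      assume "\<not> (unsplit X a \<or> unsplit X a')"
      then show False using two_degree_le_blocked[OF assms(1)] le lt by linarith
    qed
    ultimately show "(a \<in> X \<longleftrightarrow> a' \<in> X) \<and> (unsplit X a \<or> unsplit X a')" by (rule conjI)
  next
    assume X: "(a \<in> X \<longleftrightarrow> a' \<in> X) \<and> (unsplit X a \<or> unsplit X a')"
    from X[THEN conjunct2] show "card V - 1 \<le> card (HE `` {\<pi> X})"
    proof
      assume "unsplit X a"
      then show ?thesis using two_degree_ge[OF assms(1) X[THEN conjunct1] A(1) _ assms(2)] by simp
    next
      assume "unsplit X a'"
      then show ?thesis using two_degree_ge[OF assms(1) X[THEN conjunct1] A(2) _ assms(2)] by simp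
    qed
  qed
qed

text \<open>The neighbourhood of \<open>\<alpha>\<close> lies wholly inside or wholly outside
  \<open>Y\<close>, two different options because it is nonempty; the rest of \<open>B\<close> is
  free.\<close>

lemma two_card_unsplit:
  assumes "\<alpha> \<in> A"
  shows "card {Y \<in> Pow B. unsplit Y \<alpha>} = 2 * 2 ^ card (B - E `` {\<alpha>})"
proof -
  let ?N = "E `` {\<alpha>}"
  have "?N \<subseteq> B" using neighbours_A[OF assms] .
  have "?N \<noteq> {}" using assms A_eq common by blast
  have "{Y \<in> Pow B. unsplit Y \<alpha>} = Pow (B - ?N) \<union> (\<lambda>Y. Y \<union> ?N) ` Pow (B - ?N)"
  proof (intro equalityI subsetI)
    fix Y assume Y: "Y \<in> {Y \<in> Pow B. unsplit Y \<alpha>}"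
    show "Y \<in> Pow (B - ?N) \<union> (\<lambda>Y. Y \<union> ?N) ` Pow (B - ?N)"
    proof (cases "?N \<subseteq> Y")
      case True
      then have "Y = (Y - ?N) \<union> ?N" by blast
      then have "Y \<in> (\<lambda>Y. Y \<union> ?N) ` Pow (B - ?N)" using Y by blast
      then show ?thesis ..
    next
      case False
      then have "Y \<in> Pow (B - ?N)" using Y unfolding unsplit_iff by blast
      then show ?thesis ..
    qed
  next
    fix Y assume "Y \<in> Pow (B - ?N) \<union> (\<lambda>Y. Y \<union> ?N) ` Pow (B - ?N)"
    then show "Y \<in> {Y \<in> Pow B. unsplit Y \<alpha>}"
      using \<open>?N \<subseteq> B\<close> unfolding unsplit_iff by blast
  qed
  moreover have "Pow (B - ?N) \<inter> (\<lambda>Y. Y \<union> ?N) ` Pow (B - ?N) = {}"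
    using \<open>?N \<noteq> {}\<close> by blast
  moreover have "inj_on (\<lambda>Y. Y \<union> ?N) (Pow (B - ?N))"
    by (rule inj_onI) blast
  moreover have "finite (Pow (B - ?N))" using finite_B by simp
  ultimately show ?thesis
    using finite_B by (simp add: card_Un_disjoint card_image card_Pow)
qed

text \<open>The vertex \<open>c\<close> lies in both neighbourhoods, so its membership decides for
  both, and together they cover \<open>B\<close>.\<close>

lemma two_unsplit_both:
  "{Y \<in> Pow B. unsplit Y a} \<inter> {Y \<in> Pow B. unsplit Y a'} = {{}, B}"
proof (intro equalityI subsetI)
  fix Y assume "Y \<in> {Y \<in> Pow B. unsplit Y a} \<inter> {Y \<in> Pow B. unsplit Y a'}"
  then have Y: "Y \<subseteq> B" "unsplit Y a" "unsplit Y a'" by auto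
  show "Y \<in> {{}, B}"
  proof (cases "c \<in> Y")
    case True
    then have "E `` {a} \<subseteq> Y" "E `` {a'} \<subseteq> Y" using Y(2,3) common unfolding unsplit_iff by blast+
    then show ?thesis using cover Y(1) by blast
  next
    case False
    then have "E `` {a} \<inter> Y = {}" "E `` {a'} \<inter> Y = {}"
      using Y(2,3) common unfolding unsplit_iff by blast+
    then show ?thesis using cover Y(1) by blast
  qed
next
  fix Y assume "Y \<in> {{}, B}"
  then show "Y \<in> {Y \<in> Pow B. unsplit Y a} \<inter> {Y \<in> Pow B. unsplit Y a'}"
    using cover unfolding unsplit_iff by blast
qed

text \<open>
  With \<open>p\<close> and \<open>q\<close> leaves attached to \<open>a'\<close> and \<open>a\<close>, this number determines \<open>2 ^ p + 2 ^ q\<close>, which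
  together with \<open>p + q\<close> determines the unordered pair.
\<close>

lemma two_card_max_degree:
  assumes "3 \<le> card B"
  shows "card {x \<in> HV. card V - 1 \<le> card (HE `` {x})} + 1 =
    2 ^ card (B - E `` {a}) + 2 ^ card (B - E `` {a'})"
proof -
  let ?F = "{Y \<in> Pow B. unsplit Y a}" and ?F' = "{Y \<in> Pow B. unsplit Y a'}"
  have fin: "finite ?F" "finite ?F'" using finite_B by auto
  have "B \<noteq> {}" using c_in_B by blast
  then have "card (?F \<inter> ?F') = 2" unfolding two_unsplit_both by simp
  \<comment> \<open>The sets \<open>{}\<close> and \<open>B\<close> belong to both families, hence
    the \<open>+ 2\<close>.\<close>
  then have cF: "card (?F \<union> ?F') + 2 = 2 * 2 ^ card (B - E `` {a}) + 2 * 2 ^ card (B - E `` {a'})"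
    using card_Un_Int[OF fin] two_card_unsplit A_eq by simp
  have ub: "unsplit X \<alpha> \<longleftrightarrow> unsplit (X \<inter> B) \<alpha>" if "\<alpha> \<in> A" for X \<alpha>
    using neighbours_A[OF that] unfolding unsplit_iff by blast
  \<comment> \<open>Whether a vertex of \<open>A\<close> is unsplit depends on
    \<open>X \<inter> B\<close> alone, while agreement at \<open>a\<close> and \<open>a'\<close>
    leaves just \<open>{}\<close> and \<open>A\<close> for \<open>X \<inter> A\<close>.\<close>
  have "{X \<in> Pow V. card V - 1 \<le> card (HE `` {\<pi> X})} = (\<lambda>(S, Y). S \<union> Y) ` ({{}, A} \<times> (?F \<union> ?F'))"
  proof (intro equalityI subsetI)
    fix X assume "X \<in> {X \<in> Pow V. card V - 1 \<le> card (HE `` {\<pi> X})}"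
    then have X: "X \<subseteq> V" "a \<in> X \<longleftrightarrow> a' \<in> X" "unsplit X a \<or> unsplit X a'"
      using two_degree_iff[OF _ assms] by auto
    have "X = (X \<inter> A) \<union> (X \<inter> B)" using X(1) bipartition(1) by blast
    moreover have "X \<inter> A \<in> {{}, A}" using X(2) A_eq by blast
    moreover have "X \<inter> B \<in> ?F \<union> ?F'" using X(3) ub A_eq by blast
    ultimately show "X \<in> (\<lambda>(S, Y). S \<union> Y) ` ({{}, A} \<times> (?F \<union> ?F'))" by blast
  next
    fix X assume "X \<in> (\<lambda>(S, Y). S \<union> Y) ` ({{}, A} \<times> (?F \<union> ?F'))"
    then obtain S Y where SY: "S \<in> {{}, A}" "Y \<in> ?F \<union> ?F'" "X = S \<union> Y" by blast
    then have "Y \<subseteq> B" by blast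
    then have "X \<inter> B = Y" "X \<subseteq> V" "a \<in> X \<longleftrightarrow> a' \<in> X"
      using SY(1,3) bipartition(1,2) A_eq by blast+
    then show "X \<in> {X \<in> Pow V. card V - 1 \<le> card (HE `` {\<pi> X})}"
      using two_degree_iff[OF _ assms] ub[of a X] ub[of a' X] A_eq SY(2) by auto
  qed
  moreover have "inj_on (\<lambda>(S, Y). S \<union> Y) ({{}, A} \<times> (?F \<union> ?F'))"
  proof (rule inj_on_inverseI[of _ "\<lambda>X. (X \<inter> A, X \<inter> B)"])
    fix p assume "p \<in> {{}, A} \<times> (?F \<union> ?F')"
    then show "((case p of (S, Y) \<Rightarrow> S \<union> Y) \<inter> A, (case p of (S, Y) \<Rightarrow> S \<union> Y) \<inter> B) = p"
      using bipartition(2) by auto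
  qed
  moreover have "card {{}, A} = 2" using A_eq by simp
  ultimately have "card {X \<in> Pow V. card V - 1 \<le> card (HE `` {\<pi> X})} = 2 * card (?F \<union> ?F')"
    by (simp add: card_image card_cartesian_product)
  moreover have "2 \<le> card V" using two_card_V by simp
  ultimately have "4 * card {x \<in> HV. card V - 1 \<le> card (HE `` {x})} = 2 * card (?F \<union> ?F')"
    using card_fibres[of "\<lambda>x. card V - 1 \<le> card (HE `` {x})"] by simp
  then show ?thesis using cF by simp
qed

end

lemma small_side_degree_le:
  assumes "card A = 1 \<or> card A = 2" "2 \<le> card V" "x \<in> HV"
  shows "card (HE `` {x}) \<le> card V - 1"
proof (cases "card A = 1")
  case True
  then show ?thesis using star_degree_le assms(3) by blast
next
  case False
  then have "card A = 2" using assms(1) by blast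
  then obtain a a' where aa: "A = {a, a'}" "a \<noteq> a'" by (auto simp: card_2_iff)
  obtain c where "E `` {a} \<union> E `` {a'} = B" "E `` {a} \<inter> E `` {a'} = {c}"
    using two_neighbourhoods[OF aa] sides_nonempty[OF assms(2)] by blast
  then show ?thesis using two_degree_le[OF aa] assms(3) \<pi>_image by blast
qed

text \<open>The set \<open>{a}\<close> separates \<open>a\<close> from \<open>a'\<close> and so
  blocks their common neighbour.\<close>

lemma two_ex_small_degree:
  assumes "card A = 2" "2 \<le> card V"
  shows "\<exists>x\<in>HV. card (HE `` {x}) \<le> card V - 2"
proof -
  obtain a a' where aa: "A = {a, a'}" "a \<noteq> a'" using assms(1) by (auto simp: card_2_iff)
  obtain c where c: "E `` {a} \<union> E `` {a'} = B" "E `` {a} \<inter> E `` {a'} = {c}"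
    using two_neighbourhoods[OF aa] sides_nonempty[OF assms(2)] by blast
  have "{a} \<subseteq> V" using aa bipartition(1) by blast
  then have "card (HE `` {\<pi> {a}}) \<le> card V - 2"
    using two_degree_le_split[OF aa c] aa by simp
  then show ?thesis using \<open>{a} \<subseteq> V\<close> \<pi>_image by blast
qed

section \<open>Trees with at least three vertices on both sides\<close>

context
  assumes big: "3 \<le> card A" "3 \<le> card B"
begin

text \<open>Taking \<open>x = y\<close> covers singletons as well.\<close>

lemma pair_not_side: "{x, y} \<notin> {A, B, V}"
proof -
  have "card {x, y} \<le> 2" by (simp add: card_insert_if)
  moreover have "card V \<ge> 6" using big card_V by simp
  ultimately show ?thesis using big by auto
qed

lemma big_degree_empty: "card V \<le> card (HE `` {\<pi> {}})"
proof (rule degree_ge)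
  show "unsplit {} v" for v unfolding unsplit_def by blast
  show "{v} \<notin> {A, B, V}" for v using pair_not_side[of v v] by simp
  show "{v, w} \<notin> {A, B, V}" for v w by (rule pair_not_side)
qed auto

text \<open>Degree \<open>card V\<close> needs every vertex to be unsplit, and
  \<open>all_unsplit_trivial\<close> then leaves only the class of the empty set.\<close>

lemma big_degree_unique:
  assumes "x \<in> HV" "card V \<le> card (HE `` {x})"
  shows "x = \<pi> {}"
proof -
  obtain X where X: "X \<subseteq> V" "x = \<pi> X" using assms(1) \<pi>_image by blast
  have "card (HE `` {\<pi> X}) \<le> card {v \<in> V. unsplit X v}"
    using finite_V by (intro degree_le[OF X(1)]) auto
  then have "card V \<le> card {v \<in> V. unsplit X v}" using assms(2) X(2) by simp
  then have "{v \<in> V. unsplit X v} = V"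
    using finite_V by (intro card_seteq) auto
  then have "X \<in> {{}, A, B, V}" using X(1) by (intro all_unsplit_trivial) auto
  then show ?thesis using \<pi>_eq_iff[OF X(1), of "{}"] X(2) by simp
qed

lemma big_neighbours_empty: "HE `` {\<pi> {}} = (\<lambda>v. \<pi> {v}) ` V"
proof -
  have "\<pi> {v} \<noteq> \<pi> {}" if "v \<in> V" for v
    using toggle_eq_self_iff[of "{}" v] that pair_not_side[of v v] by simp
  moreover have "unsplit {} v" for v unfolding unsplit_def by blast
  ultimately show ?thesis using neighbours_\<pi>[of "{}"] by auto
qed

lemma big_singletons_inj: "inj_on (\<lambda>v. \<pi> {v}) V"
proof (rule inj_onI, rule ccontr)
  fix v w assume "v \<in> V" "w \<in> V" "\<pi> {v} = \<pi> {w}" "v \<noteq> w"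
  then show False using toggle_eq_iff[of "{}" v w] pair_not_side[of v w] by simp
qed

text \<open>The neighbourhood of \<open>w\<close> misses \<open>v\<close>, so \<open>w\<close> can
  still be toggled after \<open>v\<close>, and by symmetry \<open>v\<close> after \<open>w\<close>.
  The class of \<open>{v, w}\<close> thus becomes a common neighbour.\<close>

lemma big_common_neighbour_if_not_arc:
  assumes "v \<in> V" "w \<in> V" "v \<noteq> w" "(v, w) \<notin> E"
  shows "\<pi> {v, w} \<noteq> \<pi> {}" "(\<pi> {v}, \<pi> {v, w}) \<in> HE"
proof -
  have "\<pi> {v, w} \<noteq> \<pi> {}"
    using \<pi>_eq_iff[of "{v, w}" "{}"] assms pair_not_side[of v w] by simp
  then show "\<pi> {v, w} \<noteq> \<pi> {}" .
  have eq: "sym_diff {v} {w} = {v, w}" using assms(3) by blast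
  have "unsplit {v} w" using assms(4) arc_sym unfolding unsplit_def by blast
  moreover have "\<pi> {v} \<noteq> \<pi> {v, w}"
    using toggle_eq_self_iff[of "{v}" w] assms pair_not_side[of w w] unfolding eq by auto
  ultimately show "(\<pi> {v}, \<pi> {v, w}) \<in> HE"
    using HE_iff[of "{v}" "{v, w}"] assms eq by auto
qed

text \<open>Another common neighbour would come from toggling \<open>x\<close> after
  \<open>v\<close> and \<open>y\<close> after \<open>w\<close>. Sizes force the two resulting sets
  to be equal, so \<open>x = w\<close> and \<open>y = v\<close>. But \<open>w\<close> is unsplit by
  \<open>{v}\<close> only if \<open>v\<close> is its sole neighbour, and conversely, so the tree
  would be a single edge.\<close>

lemma big_no_common_neighbour_if_arc:
  assumes "(v, w) \<in> E" "(\<pi> {v}, z) \<in> HE" "(\<pi> {w}, z) \<in> HE"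
  shows "z = \<pi> {}"
proof (rule ccontr)
  assume zne: "z \<noteq> \<pi> {}"
  have V: "v \<in> V" "w \<in> V" using arc_in_V[OF assms(1)] by auto
  have "v \<noteq> w" using arc_neq[OF assms(1)] .
  obtain x where x: "x \<in> V" "unsplit {v} x" "z = \<pi> (sym_diff {v} {x})"
    using assms(2) neighbours_\<pi>[of "{v}"] V by auto
  obtain y where y: "y \<in> V" "unsplit {w} y" "z = \<pi> (sym_diff {w} {y})"
    using assms(3) neighbours_\<pi>[of "{w}"] V by auto
  define D where "D = sym_diff (sym_diff {v} {x}) (sym_diff {w} {y})"
  have sub: "sym_diff {v} {x} \<subseteq> V" "sym_diff {w} {y} \<subseteq> V" using V x(1) y(1) by auto
  have "D \<in> {{}, A, B, V}"
    unfolding D_def \<pi>_eq_iff[OF sub, symmetric] x(3)[symmetric] by (rule y(3))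
  moreover have "D \<noteq> V"
  proof
    assume "D = V"
    then have "V \<subseteq> {v, x, w, y}" unfolding D_def by blast
    then have "card V \<le> card {v, x, w, y}" by (intro card_mono) auto
    also have "\<dots> \<le> 4" by (simp add: card_insert_if)
    finally show False using big card_V by simp
  qed
  \<comment> \<open>\<open>D\<close> may have four elements, so size alone does not exclude a side.
    A side misses one of the adjacent \<open>v\<close> and \<open>w\<close>; for that vertex to
    cancel in \<open>D\<close> it must equal \<open>x\<close> or \<open>y\<close>, which leaves at
    most two elements.\<close>
  moreover have "D \<noteq> A \<and> D \<noteq> B"
  proof -
    have "w \<notin> D \<Longrightarrow> D \<subseteq> {v, x} \<or> D \<subseteq> {v, y}"
      using \<open>v \<noteq> w\<close> unfolding D_def by auto
    moreover have "v \<notin> D \<Longrightarrow> D \<subseteq> {w, x} \<or> D \<subseteq> {w, y}"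
      using \<open>v \<noteq> w\<close> unfolding D_def by auto
    moreover have "card D \<le> 2" if "D \<subseteq> {p, q}" for p q
      using card_mono[OF _ that] by (simp add: card_insert_if split: if_splits)
    ultimately have "card D \<le> 2" if "v \<notin> D \<or> w \<notin> D" using that by blast
    moreover have "v \<notin> A \<or> w \<notin> A" "v \<notin> B \<or> w \<notin> B"
      using arc_side[OF assms(1)] V bipartition(1,2) by auto
    ultimately show ?thesis using big by auto
  qed
  ultimately have "D = {}" by blast
  then have eq: "sym_diff {v} {x} = sym_diff {w} {y}" unfolding D_def by blast
  have "x \<noteq> v" using x(3) zne by auto
  then have "x = w" "y = v" using eq \<open>v \<noteq> w\<close> by blast+
  then have w: "E `` {w} = {v}" using x(2) arc_sym[OF assms(1)] unfolding unsplit_iff by blast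
  have v: "E `` {v} = {w}" using y(2) \<open>y = v\<close> assms(1) unfolding unsplit_iff by blast
  have "{v, w} = {} \<or> {v, w} = V"
  proof (rule closed_trivial)
    show "p \<in> {v, w} \<longleftrightarrow> q \<in> {v, w}" if "(p, q) \<in> E" for p q
      using v w that arc_sym[OF that] by blast
  qed (use V in blast)
  then show False using pair_not_side[of v w] by blast
qed

lemma big_arc_iff:
  assumes "v \<in> V" "w \<in> V" "v \<noteq> w"
  shows "(v, w) \<in> E \<longleftrightarrow> \<not> (\<exists>z. z \<noteq> \<pi> {} \<and> (\<pi> {v}, z) \<in> HE \<and> (\<pi> {w}, z) \<in> HE)"
proof
  assume "(v, w) \<in> E"
  then show "\<not> (\<exists>z. z \<noteq> \<pi> {} \<and> (\<pi> {v}, z) \<in> HE \<and> (\<pi> {w}, z) \<in> HE)"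
    using big_no_common_neighbour_if_arc by blast
next
  assume no: "\<not> (\<exists>z. z \<noteq> \<pi> {} \<and> (\<pi> {v}, z) \<in> HE \<and> (\<pi> {w}, z) \<in> HE)"
  show "(v, w) \<in> E"
  proof (rule ccontr)
    assume n: "(v, w) \<notin> E"
    then have "(w, v) \<notin> E" using arc_sym by blast
    then have "(\<pi> {w}, \<pi> {v, w}) \<in> HE"
      using big_common_neighbour_if_not_arc(2)[OF assms(2,1) assms(3)[symmetric]]
      by (simp add: insert_commute)
    then show False using no big_common_neighbour_if_not_arc[OF assms n] by blast
  qed
qed

end

end

section \<open>Isomorphisms\<close>

definition graph_iso :: "'a set \<Rightarrow> 'a rel \<Rightarrow> 'b set \<Rightarrow> 'b rel \<Rightarrow> ('a \<Rightarrow> 'b) \<Rightarrow> bool" where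
  "graph_iso V E V' E' f \<longleftrightarrow> bij_betw f V V' \<and> (\<forall>u\<in>V. \<forall>v\<in>V. (u, v) \<in> E \<longleftrightarrow> (f u, f v) \<in> E')"

text \<open>Arcs are pairs with \<open>fst\<close> and \<open>snd\<close> as their ends, so the arc
  map of a library isomorphism is forced by its vertex map, and conversely
  \<open>map_prod f f\<close> supplies one.\<close>

lemma digraph_iso_with_proj_iff:
  assumes G: "parcs G \<subseteq> pverts G \<times> pverts G" and H: "parcs H \<subseteq> pverts H \<times> pverts H"
  shows "digraph_iso (with_proj G) (with_proj H) \<longleftrightarrow>
    (\<exists>f. graph_iso (pverts G) (parcs G) (pverts H) (parcs H) f)"
proof
  assume "digraph_iso (with_proj G) (with_proj H)"
  then obtain h where h: "pre_digraph.digraph_isomorphism (with_proj G) h"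
      "with_proj H = app_iso h (with_proj G)"
    unfolding digraph_iso_def by blast
  let ?f = "iso_verts h"
  have inj: "inj_on ?f (pverts G)"
    using h(1) unfolding pre_digraph.digraph_isomorphism_def by simp
  have pv: "pverts H = ?f ` pverts G" and pa: "parcs H = iso_arcs h ` parcs G"
    and "fst = iso_tail h" "snd = iso_head h"
    using arg_cong[OF h(2), of verts] arg_cong[OF h(2), of arcs]
      arg_cong[OF h(2), of tail] arg_cong[OF h(2), of head] by simp_all
  then have arc: "iso_arcs h (u, v) = (?f u, ?f v)" if "(u, v) \<in> parcs G" for u v
    using h(1) that unfolding pre_digraph.digraph_isomorphism_def
    by (intro prod_eqI) fastforce+
  have "(u, v) \<in> parcs G \<longleftrightarrow> (?f u, ?f v) \<in> parcs H" if "u \<in> pverts G" "v \<in> pverts G" for u v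
  proof
    assume "(u, v) \<in> parcs G"
    then show "(?f u, ?f v) \<in> parcs H" unfolding pa using arc by (metis imageI)
  next
    assume "(?f u, ?f v) \<in> parcs H"
    then obtain x y where xy: "(x, y) \<in> parcs G" "(?f u, ?f v) = iso_arcs h (x, y)"
      unfolding pa by auto
    then have "?f u = ?f x" "?f v = ?f y" using arc by auto
    then show "(u, v) \<in> parcs G"
      using xy(1) G that inj_onD[OF inj, of u x] inj_onD[OF inj, of v y] by auto
  qed
  then show "\<exists>f. graph_iso (pverts G) (parcs G) (pverts H) (parcs H) f"
    using inj pv unfolding graph_iso_def bij_betw_def by auto
next
  assume "\<exists>f. graph_iso (pverts G) (parcs G) (pverts H) (parcs H) f"
  then obtain f where bij: "bij_betw f (pverts G) (pverts H)"
    and arc: "\<And>u v. u \<in> pverts G \<Longrightarrow> v \<in> pverts G \<Longrightarrow> (u, v) \<in> parcs G \<longleftrightarrow> (f u, f v) \<in> parcs H"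
    unfolding graph_iso_def by blast
  have inj: "inj_on f (pverts G)" and im: "f ` pverts G = pverts H"
    using bij unfolding bij_betw_def by auto
  define h where "h = \<lparr>iso_verts = f, iso_arcs = map_prod f f, iso_head = snd, iso_tail = fst\<rparr>"
  have "inj_on (map_prod f f) (parcs G)"
    using map_prod_inj_on[OF inj inj] G by (rule inj_on_subset)
  moreover have "wf_digraph (with_proj G)"
    using G unfolding wf_digraph_wp_iff pair_wf_digraph_def by auto
  ultimately have "pre_digraph.digraph_isomorphism (with_proj G) h"
    using inj unfolding pre_digraph.digraph_isomorphism_def h_def by auto
  moreover have "map_prod f f ` parcs G = parcs H"
  proof (intro equalityI subsetI)
    fix e assume "e \<in> map_prod f f ` parcs G"
    then show "e \<in> parcs H" using arc G by auto
  next
    fix e assume e: "e \<in> parcs H"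
    then obtain x y where xy: "e = (x, y)" "x \<in> f ` pverts G" "y \<in> f ` pverts G"
      using H im by auto
    then obtain u v where "u \<in> pverts G" "v \<in> pverts G" "x = f u" "y = f v" by blast
    then show "e \<in> map_prod f f ` parcs G"
      using arc e xy(1) by (intro image_eqI[of _ _ "(u, v)"]) auto
  qed
  then have "with_proj H = app_iso h (with_proj G)"
    unfolding app_iso_def h_def using im by (simp add: with_proj_def)
  ultimately show "digraph_iso (with_proj G) (with_proj H)"
    unfolding digraph_iso_def by blast
qed

lemma graph_iso_degree:
  assumes "graph_iso V E V' E' f" "E \<subseteq> V \<times> V" "E' \<subseteq> V' \<times> V'" "x \<in> V"
  shows "card (E' `` {f x}) = card (E `` {x})"
proof -
  have inj: "inj_on f V" and im: "f ` V = V'"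
    and arc: "\<And>u v. u \<in> V \<Longrightarrow> v \<in> V \<Longrightarrow> (u, v) \<in> E \<longleftrightarrow> (f u, f v) \<in> E'"
    using assms(1) unfolding graph_iso_def bij_betw_def by auto
  have "E' `` {f x} = f ` (E `` {x})"
  proof (intro equalityI subsetI)
    fix y assume y: "y \<in> E' `` {f x}"
    then have "y \<in> f ` V" using assms(3) im by blast
    then obtain v where v: "v \<in> V" "y = f v" by blast
    then have "(x, v) \<in> E" using arc[OF assms(4) v(1)] y by simp
    then show "y \<in> f ` (E `` {x})" using v(2) by blast
  next
    fix y assume "y \<in> f ` (E `` {x})"
    then obtain v where v: "(x, v) \<in> E" "y = f v" by blast
    then have "v \<in> V" using assms(2) by blast
    then show "y \<in> E' `` {f x}" using arc[OF assms(4)] v by simp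
  qed
  moreover have "inj_on f (E `` {x})"
    using inj by (rule inj_on_subset) (use assms(2) in blast)
  ultimately show ?thesis by (simp add: card_image)
qed

lemma graph_iso_card_degree:
  assumes iso: "graph_iso V E V' E' f" "E \<subseteq> V \<times> V" "E' \<subseteq> V' \<times> V'"
  shows "card {x \<in> V. Q (card (E `` {x}))} = card {x \<in> V'. Q (card (E' `` {x}))}"
proof -
  have bij: "inj_on f V" "f ` V = V'"
    using iso(1) unfolding graph_iso_def bij_betw_def by auto
  have im: "f ` {x \<in> V. Q (card (E `` {x}))} = {x \<in> V'. Q (card (E' `` {x}))}"
    unfolding bij(2)[symmetric] using graph_iso_degree[OF iso] by auto
  have "inj_on f {x \<in> V. Q (card (E `` {x}))}"
    using bij(1) by (rule inj_on_subset) blast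
  from card_image[OF this] show ?thesis unfolding im by (rule sym)
qed

lemma graph_iso_ex_degree:
  assumes iso: "graph_iso V E V' E' f" "E \<subseteq> V \<times> V" "E' \<subseteq> V' \<times> V'"
  shows "(\<exists>x\<in>V. Q (card (E `` {x}))) \<longleftrightarrow> (\<exists>x\<in>V'. Q (card (E' `` {x})))"
proof -
  have "V' = f ` V" using iso(1) unfolding graph_iso_def bij_betw_def by auto
  then show ?thesis using graph_iso_degree[OF iso] by auto
qed

section \<open>Rebuilding trees with a small side\<close>

text \<open>Every edge has an end in \<open>A\<close>, so the neighbourhoods of the vertices of
  \<open>A\<close> carry all adjacencies.\<close>

lemma bipartite_graph_isoI:
  assumes "bipartite_tree V E A B" "bipartite_tree V' E' A' B'"
    and bij: "bij_betw f V V'" and "f ` A = A'"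
    and nb: "\<And>a. a \<in> A \<Longrightarrow> f ` (E `` {a}) = E' `` {f a}"
  shows "graph_iso V E V' E' f"
proof -
  interpret T: bipartite_tree V E A B by fact
  interpret T': bipartite_tree V' E' A' B' by fact
  have inj: "inj_on f V" and im: "f ` V = V'" using bij unfolding bij_betw_def by auto
  have A: "a \<in> A \<longleftrightarrow> f a \<in> A'" if "a \<in> V" for a
    using that assms(4) inj T.bipartition(1) by (metis Un_upper1 inj_on_image_mem_iff)
  have from_A: "(u, v) \<in> E \<longleftrightarrow> (f u, f v) \<in> E'" if "u \<in> A" "v \<in> V" for u v
  proof -
    have "E `` {u} \<subseteq> V" using T.arc_in_V by blast
    then have "v \<in> E `` {u} \<longleftrightarrow> f v \<in> f ` (E `` {u})"
      using inj_on_image_mem_iff[OF inj that(2)] by blast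
    then show ?thesis unfolding nb[OF that(1)] by simp
  qed
  have "(u, v) \<in> E \<longleftrightarrow> (f u, f v) \<in> E'" if uv: "u \<in> V" "v \<in> V" for u v
  proof (cases "u \<in> A")
    case True
    then show ?thesis using from_A uv by blast
  next
    case u: False
    show ?thesis
    proof (cases "v \<in> A")
      case True
      have "(v, u) \<in> E \<longleftrightarrow> (f v, f u) \<in> E'" using from_A[OF True uv(1)] .
      then show ?thesis using T.arc_sym T'.arc_sym by blast
    next
      case False
      then show ?thesis
        using u A[OF uv(1)] A[OF uv(2)] T.arc_side[of u v] T'.arc_side[of "f u" "f v"] by blast
    qed
  qed
  then show ?thesis using bij unfolding graph_iso_def by blast
qed

lemma star_graph_iso:
  assumes "bipartite_tree V E A B" "bipartite_tree V' E' A' B'"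
    and "card A = 1" "card A' = 1" "card V = card V'" "2 \<le> card V"
  shows "\<exists>f. graph_iso V E V' E' f"
proof -
  interpret T: bipartite_tree V E A B by fact
  interpret T': bipartite_tree V' E' A' B' by fact
  obtain a where a: "A = {a}" using assms(3) card_1_singletonE by blast
  obtain a' where a': "A' = {a'}" using assms(4) card_1_singletonE by blast
  have "card B = card B'" using T.card_V T'.card_V assms(3-5) by simp
  then obtain g where g: "bij_betw g B B'"
    using finite_same_card_bij[OF T.finite_B T'.finite_B] by blast
  let ?f = "g(a := a')"
  have aB: "a \<notin> B" "a' \<notin> B'" using a a' T.bipartition(2) T'.bipartition(2) by auto
  have gB: "?f ` B = B'"
    using g aB(1) unfolding bij_betw_def by auto
  have "bij_betw ?f V V'"
  proof -
    have "bij_betw ?f B B'"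
      using g aB(1) by (subst bij_betw_cong[of B _ g]) auto
    moreover have "bij_betw ?f {a} {a'}" by (simp add: bij_betw_def)
    moreover have "{a} \<inter> B = {}" "{a'} \<inter> B' = {}" using aB by auto
    ultimately have "bij_betw ?f ({a} \<union> B) ({a'} \<union> B')" by (intro bij_betw_combine)
    then show ?thesis using a a' T.bipartition(1) T'.bipartition(1) by simp
  qed
  moreover have "E `` {a} = B"
  proof (intro equalityI subsetI)
    fix b assume b: "b \<in> B"
    then have "E `` {b} \<noteq> {}" using T.neighbours_nonempty[OF assms(6)] T.bipartition(1) by blast
    then show "b \<in> E `` {a}" using T.neighbours_B[OF b] a T.arc_sym by blast
  qed (use T.neighbours_A a in blast)
  moreover have "E' `` {a'} = B'"
  proof (intro equalityI subsetI)
    fix b assume b: "b \<in> B'"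
    then have "E' `` {b} \<noteq> {}"
      using T'.neighbours_nonempty assms(5,6) T'.bipartition(1) by auto
    then show "b \<in> E' `` {a'}" using T'.neighbours_B[OF b] a' T'.arc_sym by blast
  qed (use T'.neighbours_A a' in blast)
  ultimately have "graph_iso V E V' E' ?f"
    using gB a a' by (intro bipartite_graph_isoI[OF assms(1,2)]) auto
  then show ?thesis by blast
qed

text \<open>\<open>B\<close> consists of the common neighbour and the private leaves of
  \<open>a\<close> and of \<open>b\<close>; equal numbers of private leaves allow them to be matched
  group by group.\<close>

lemma double_star_graph_iso:
  assumes "bipartite_tree V E A B" "bipartite_tree V' E' A' B'"
    and A: "A = {a, b}" "a \<noteq> b" and A': "A' = {a', b'}" "a' \<noteq> b'"
    and B: "E `` {a} \<union> E `` {b} = B" "E `` {a} \<inter> E `` {b} = {c}"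
    and B': "E' `` {a'} \<union> E' `` {b'} = B'" "E' `` {a'} \<inter> E' `` {b'} = {c'}"
    and ca: "card (B - E `` {a}) = card (B' - E' `` {a'})"
    and cb: "card (B - E `` {b}) = card (B' - E' `` {b'})"
  shows "\<exists>f. graph_iso V E V' E' f"
proof -
  interpret T: bipartite_tree V E A B by fact
  interpret T': bipartite_tree V' E' A' B' by fact
  \<comment> \<open>\<open>P\<close> avoids the neighbours of \<open>a\<close>, so it holds the
    private leaves of \<open>b\<close>; \<open>Q\<close> holds those of \<open>a\<close>.\<close>
  define P Q P' Q' where "P = B - E `` {a}" and "Q = B - E `` {b}"
    and "P' = B' - E' `` {a'}" and "Q' = B' - E' `` {b'}"
  obtain g where g: "bij_betw g P P'"
    using finite_same_card_bij[of P P'] T.finite_B T'.finite_B ca unfolding P_def P'_def by auto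
  obtain h where h: "bij_betw h Q Q'"
    using finite_same_card_bij[of Q Q'] T.finite_B T'.finite_B cb unfolding Q_def Q'_def by auto
  have abB: "a \<notin> B" "b \<notin> B" "a' \<notin> B'" "b' \<notin> B'"
    using A A' T.bipartition(2) T'.bipartition(2) by auto
  have parts: "E `` {a} = insert c Q" "E `` {b} = insert c P" "c \<notin> P" "c \<notin> Q" "P \<inter> Q = {}"
    "B = insert c (P \<union> Q)"
    using B unfolding P_def Q_def by blast+
  have parts': "E' `` {a'} = insert c' Q'" "E' `` {b'} = insert c' P'" "c' \<notin> P'" "c' \<notin> Q'"
    "P' \<inter> Q' = {}" "B' = insert c' (P' \<union> Q')"
    using B' unfolding P'_def Q'_def by blast+
  define f where "f x = (if x = a then a' else if x = b then b' else if x = c then c'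
    else if x \<in> P then g x else h x)" for x
  have f: "f a = a'" "f b = b'" "f c = c'"
    using A(2) abB parts(6) unfolding f_def by auto
  have fP: "f x = g x" if "x \<in> P" for x
    using that abB parts unfolding f_def by auto
  have fQ: "f x = h x" if "x \<in> Q" for x
    using that abB parts unfolding f_def by auto
  have bP: "bij_betw f P P'" using g fP by (subst bij_betw_cong[of P f g]) auto
  have bQ: "bij_betw f Q Q'" using h fQ by (subst bij_betw_cong[of Q f h]) auto
  have bc: "bij_betw f {c} {c'}" using f(3) by (simp add: bij_betw_def)
  have bA: "bij_betw f A A'" using f A A' by (auto simp: bij_betw_def inj_on_def)
  have "bij_betw f (P \<union> Q) (P' \<union> Q')"
    using bP bQ parts'(5) by (rule bij_betw_combine)
  then have "bij_betw f ({c} \<union> (P \<union> Q)) ({c'} \<union> (P' \<union> Q'))"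
    using parts'(3,4) by (intro bij_betw_combine[OF bc]) auto
  then have "bij_betw f B B'" using parts(6) parts'(6) by simp
  then have "bij_betw f V V'"
    unfolding T.bipartition(1) T'.bipartition(1) using T'.bipartition(2)
    by (intro bij_betw_combine[OF bA]) auto
  moreover have "f ` A = A'" using bA by (simp add: bij_betw_def)
  moreover have "f ` (E `` {x}) = E' `` {f x}" if "x \<in> A" for x
  proof -
    have "f ` P = P'" "f ` Q = Q'" using bP bQ by (simp_all add: bij_betw_def)
    then have "f ` (E `` {a}) = E' `` {f a}" "f ` (E `` {b}) = E' `` {f b}"
      unfolding parts(1,2) f parts'(1,2) by (simp_all add: f(3))
    then show ?thesis using that A(1) by blast
  qed
  ultimately have "graph_iso V E V' E' f"
    by (rule bipartite_graph_isoI[OF assms(1,2)])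
  then show ?thesis by blast
qed

text \<open>The powers have equal sums and, through the exponents, equal products, so both pairs are
  the roots of one quadratic.\<close>

lemma sum_two_powers_eq:
  fixes p q r s :: nat
  assumes "p + q = r + s" "(2::nat) ^ p + 2 ^ q = 2 ^ r + 2 ^ s"
  shows "p = r \<and> q = s \<or> p = s \<and> q = r"
proof -
  define x y z w :: int where "x = 2 ^ p" and "y = 2 ^ q" and "z = 2 ^ r" and "w = 2 ^ s"
  have sum: "x + y = z + w"
    using arg_cong[OF assms(2), of int] unfolding x_def y_def z_def w_def by simp
  have "x * y = z * w"
    using assms(1) unfolding x_def y_def z_def w_def by (simp flip: power_add)
  have "(x - z) * (x - w) = x * x - x * (z + w) + z * w" by (simp add: algebra_simps)
  also have "\<dots> = x * x - x * (x + y) + x * y" by (simp only: sum \<open>x * y = z * w\<close>)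
  also have "\<dots> = 0" by (simp add: algebra_simps)
  finally have "x = z \<or> x = w" by simp
  then have "p = r \<or> p = s" unfolding x_def z_def w_def by simp
  then show ?thesis using assms(1) by auto
qed

lemma tree_model_two_iso:
  assumes M: "tree_model V E A B HV HE \<pi>" "tree_model V' E' A' B' HV' HE' \<pi>'"
    and iso: "graph_iso HV HE HV' HE' \<phi>"
    and cV: "card V = card V'" and cA: "card A = 2" "card A' = 2" "2 \<le> card B"
  shows "\<exists>f. graph_iso V E V' E' f"
proof -
  interpret M: tree_model V E A B HV HE \<pi> by fact
  interpret M': tree_model V' E' A' B' HV' HE' \<pi>' by fact
  have bt: "bipartite_tree V E A B" "bipartite_tree V' E' A' B'" by unfold_locales
  have cB: "card B = card B'" using M.card_V M'.card_V cV cA by simp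
  obtain a b where A: "A = {a, b}" "a \<noteq> b" using cA(1) by (auto simp: card_2_iff)
  obtain a' b' where A': "A' = {a', b'}" "a' \<noteq> b'" using cA(2) by (auto simp: card_2_iff)
  have "B \<noteq> {}" "B' \<noteq> {}" using cA(3) cB by auto
  obtain c where c: "E `` {a} \<union> E `` {b} = B" "E `` {a} \<inter> E `` {b} = {c}"
    using M.two_neighbourhoods[OF A \<open>B \<noteq> {}\<close>] .
  obtain c' where c': "E' `` {a'} \<union> E' `` {b'} = B'" "E' `` {a'} \<inter> E' `` {b'} = {c'}"
    using M'.two_neighbourhoods[OF A' \<open>B' \<noteq> {}\<close>] .
  let ?p = "card (B - E `` {a})" and ?q = "card (B - E `` {b})"
  let ?p' = "card (B' - E' `` {a'})" and ?q' = "card (B' - E' `` {b'})"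
  have leaves: "card (X - N) + card (X - N') + 1 = card X"
    if "finite X" "N \<union> N' = X" "N \<inter> N' = {z}" for X N N' :: "'z set" and z
  proof -
    have "X = insert z ((X - N) \<union> (X - N'))" "z \<notin> (X - N) \<union> (X - N')"
      using that by blast+
    moreover have "card ((X - N) \<union> (X - N')) = card (X - N) + card (X - N')"
      using that by (intro card_Un_disjoint) auto
    ultimately show ?thesis using that(1) by (metis Suc_eq_plus1 card_insert_disjoint finite_Diff finite_Un)
  qed
  have pq: "?p + ?q + 1 = card B" using leaves[OF M.finite_B c] .
  have pq': "?p' + ?q' + 1 = card B'" using leaves[OF M'.finite_B c'] .
  have "?p = ?p' \<and> ?q = ?q' \<or> ?p = ?q' \<and> ?q = ?p'"
  proof (cases "3 \<le> card B")
    case True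
    have "2 ^ ?p + 2 ^ ?q = card {x \<in> HV. card V - 1 \<le> card (HE `` {x})} + 1"
      using M.two_card_max_degree[OF A c True] by simp
    also have "\<dots> = card {x \<in> HV'. card V' - 1 \<le> card (HE' `` {x})} + 1"
      using graph_iso_card_degree[OF iso M.HE_subset M'.HE_subset, of "\<lambda>k. card V - 1 \<le> k"] cV by simp
    also have "\<dots> = 2 ^ ?p' + 2 ^ ?q'"
      using M'.two_card_max_degree[OF A' c'] True cB by simp
    finally show ?thesis using pq pq' cB by (intro sum_two_powers_eq) auto
  next
    \<comment> \<open>Now \<open>B\<close> has two elements and \<open>?p + ?q = 1\<close> in either
      tree, so the unordered pairs agree without any degree count.\<close>
    case False
    then show ?thesis using pq pq' cB cA(3) by arith
  qed
  then show ?thesis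
  proof
    assume "?p = ?p' \<and> ?q = ?q'"
    then show ?thesis using double_star_graph_iso[OF bt A A' c c'] by blast
  next
    assume "?p = ?q' \<and> ?q = ?p'"
    moreover have "A' = {b', a'}" "b' \<noteq> a'" "E' `` {b'} \<union> E' `` {a'} = B'" "E' `` {b'} \<inter> E' `` {a'} = {c'}"
      using A' c' by auto
    ultimately show ?thesis using double_star_graph_iso[OF bt A _ _ c] by blast
  qed
qed

section \<open>Rebuilding trees with two large sides\<close>

text \<open>\<open>\<phi>\<close> preserves the distinguished vertex of degree \<open>card V\<close>
  and hence its neighbours, the singleton classes; this induces the vertex map \<open>f\<close>. The
  description of adjacency by common neighbours in \<open>big_arc_iff\<close> carries over along
  \<open>\<phi>\<close>.\<close>

lemma tree_model_big_iso:
  assumes M: "tree_model V E A B HV HE \<pi>" "tree_model V' E' A' B' HV' HE' \<pi>'"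
    and iso: "graph_iso HV HE HV' HE' \<phi>"
    and cV: "card V = card V'" and big: "3 \<le> card A" "3 \<le> card B" "3 \<le> card A'" "3 \<le> card B'"
  shows "\<exists>f. graph_iso V E V' E' f"
proof -
  interpret M: tree_model V E A B HV HE \<pi> by fact
  interpret M': tree_model V' E' A' B' HV' HE' \<pi>' by fact
  have inj: "inj_on \<phi> HV" and im: "\<phi> ` HV = HV'"
    and arc: "\<And>x y. x \<in> HV \<Longrightarrow> y \<in> HV \<Longrightarrow> (x, y) \<in> HE \<longleftrightarrow> (\<phi> x, \<phi> y) \<in> HE'"
    using iso unfolding graph_iso_def bij_betw_def by auto
  have in_HV: "\<pi> X \<in> HV" if "X \<subseteq> V" for X using that M.\<pi>_image by blast
  have "\<phi> (\<pi> {}) \<in> HV'" using in_HV im by blast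
  moreover have "card V' \<le> card (HE' `` {\<phi> (\<pi> {})})"
    using graph_iso_degree[OF iso M.HE_subset M'.HE_subset in_HV[of "{}"]]
      M.big_degree_empty[OF big(1,2)] cV by simp
  ultimately have empty: "\<phi> (\<pi> {}) = \<pi>' {}" by (rule M'.big_degree_unique[OF big(3,4)])
  have "\<exists>v'\<in>V'. \<phi> (\<pi> {v}) = \<pi>' {v'}" if "v \<in> V" for v
  proof -
    have "(\<pi> {}, \<pi> {v}) \<in> HE" using M.big_neighbours_empty[OF big(1,2)] that by blast
    then have "(\<pi>' {}, \<phi> (\<pi> {v})) \<in> HE'"
      using arc[OF in_HV[of "{}"] in_HV[of "{v}"]] that empty by simp
    then show ?thesis using M'.big_neighbours_empty[OF big(3,4)] by blast
  qed
  then obtain f where f: "\<And>v. v \<in> V \<Longrightarrow> f v \<in> V'" "\<And>v. v \<in> V \<Longrightarrow> \<phi> (\<pi> {v}) = \<pi>' {f v}"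
    by metis
  have f_inj: "inj_on f V"
  proof (rule inj_onI)
    fix v w assume vw: "v \<in> V" "w \<in> V" "f v = f w"
    then have "\<phi> (\<pi> {v}) = \<phi> (\<pi> {w})" using f(2) by simp
    then have "\<pi> {v} = \<pi> {w}" using inj_onD[OF inj] in_HV vw by simp
    then show "v = w" using inj_onD[OF M.big_singletons_inj[OF big(1,2)]] vw by simp
  qed
  moreover have "f ` V = V'"
    using f(1) f_inj M'.finite_V cV by (intro card_seteq) (auto simp: card_image)
  ultimately have "bij_betw f V V'" unfolding bij_betw_def by blast
  moreover have "(v, w) \<in> E \<longleftrightarrow> (f v, f w) \<in> E'" if vw: "v \<in> V" "w \<in> V" for v w
  proof (cases "v = w")
    case True
    then show ?thesis using M.arc_neq[of v w] M'.arc_neq[of "f v" "f w"] by blast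
  next
    case False
    then have "f v \<noteq> f w" using inj_onD[OF f_inj] vw by blast
    have ex: "(\<exists>z. z \<noteq> \<pi> {} \<and> (\<pi> {v}, z) \<in> HE \<and> (\<pi> {w}, z) \<in> HE) \<longleftrightarrow>
      (\<exists>z. z \<noteq> \<pi>' {} \<and> (\<pi>' {f v}, z) \<in> HE' \<and> (\<pi>' {f w}, z) \<in> HE')" (is "?l \<longleftrightarrow> ?r")
    proof
      assume ?l
      then obtain z where z: "z \<noteq> \<pi> {}" "(\<pi> {v}, z) \<in> HE" "(\<pi> {w}, z) \<in> HE" by blast
      have "z \<in> HV" using z(2) M.HE_subset by blast
      moreover have "\<phi> z \<noteq> \<pi>' {}"
        using z(1) inj_onD[OF inj _ \<open>z \<in> HV\<close> in_HV[of "{}"]] empty by auto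
      moreover have "(\<pi>' {f v}, \<phi> z) \<in> HE'" "(\<pi>' {f w}, \<phi> z) \<in> HE'"
        using arc[OF in_HV \<open>z \<in> HV\<close>, of "{v}"] arc[OF in_HV \<open>z \<in> HV\<close>, of "{w}"] z(2,3) vw f(2)
        by simp_all
      ultimately show ?r by blast
    next
      assume ?r
      then obtain z' where z': "z' \<noteq> \<pi>' {}" "(\<pi>' {f v}, z') \<in> HE'" "(\<pi>' {f w}, z') \<in> HE'" by blast
      then have "z' \<in> \<phi> ` HV" using M'.HE_subset im by blast
      then obtain z where z: "z \<in> HV" "z' = \<phi> z" by blast
      have "z \<noteq> \<pi> {}" using z'(1) z(2) empty by blast
      moreover have "(\<pi> {v}, z) \<in> HE" "(\<pi> {w}, z) \<in> HE"
        using arc[OF in_HV z(1), of "{v}"] arc[OF in_HV z(1), of "{w}"] z'(2,3) z(2) vw f(2)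
        by simp_all
      ultimately show ?l by blast
    qed
    show ?thesis
      unfolding M.big_arc_iff[OF big(1,2) vw False]
        M'.big_arc_iff[OF big(3,4) f(1)[OF vw(1)] f(1)[OF vw(2)] \<open>f v \<noteq> f w\<close>] ex ..
  qed
  ultimately show ?thesis unfolding graph_iso_def by blast
qed

section \<open>Telling the cases apart\<close>

lemma tree_model_ordered:
  assumes "tree_model V E A B HV HE \<pi>"
  obtains A' B' where "tree_model V E A' B' HV HE \<pi>" "card A' \<le> card B'"
  using assms tree_model.swap_model[OF assms] by (metis nat_le_linear)

text \<open>\<open>card_HV\<close> makes \<open>card HV\<close> injective in \<open>card V\<close>
  from two vertices on. One vertex gives \<open>card HV = 1\<close>, and so do two, whence the
  excluded pair of sizes.\<close>

lemma tree_model_card_eq: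
  assumes M: "tree_model V E A B HV HE \<pi>" "tree_model V' E' A' B' HV' HE' \<pi>'"
    and cH: "card HV = card HV'" and ne: "{card V, card V'} \<noteq> {1, 2}"
  shows "card V = card V'"
proof -
  interpret M: tree_model V E A B HV HE \<pi> by fact
  interpret M': tree_model V' E' A' B' HV' HE' \<pi>' by fact
  have pos: "card V \<noteq> 0" "card V' \<noteq> 0"
    using M.finite_V M.V_nonempty M'.finite_V M'.V_nonempty by auto
  have four: "(2::nat) ^ n = 4 \<longleftrightarrow> n = 2" for n
    using power_inject_exp[of "2::nat" n 2] by simp
  show ?thesis
  proof (cases "card V = 1")
    case True
    show ?thesis
    proof (rule ccontr)
      assume "card V \<noteq> card V'"
      then have "2 \<le> card V'" using True pos by simp
      then have "(2::nat) ^ card V' = 4" using M'.card_HV M.card_HV_single[OF True] cH by simp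
      then show False using four True ne by simp
    qed
  next
    case False
    then have V: "2 \<le> card V" using pos by simp
    show ?thesis
    proof (cases "card V' = 1")
      case True
      then have "(2::nat) ^ card V = 4" using M.card_HV[OF V] M'.card_HV_single[OF True] cH by simp
      then show ?thesis using four True ne by auto
    next
      case False
      then have "2 \<le> card V'" using pos by simp
      then have "(2::nat) ^ card V = 2 ^ card V'"
        using M.card_HV[OF V] M'.card_HV cH by simp
      then show ?thesis by simp
    qed
  qed
qed

lemma tree_model_iso:
  assumes M: "tree_model V E A B HV HE \<pi>" "tree_model V' E' A' B' HV' HE' \<pi>'"
    and iso: "graph_iso HV HE HV' HE' \<phi>" and ne: "{card V, card V'} \<noteq> {1, 2}"
    and ord: "card A \<le> card B" "card A' \<le> card B'"
  shows "\<exists>f. graph_iso V E V' E' f"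
proof -
  interpret M: tree_model V E A B HV HE \<pi> by fact
  interpret M': tree_model V' E' A' B' HV' HE' \<pi>' by fact
  have bt: "bipartite_tree V E A B" "bipartite_tree V' E' A' B'" by unfold_locales
  have "card HV = card HV'" using iso unfolding graph_iso_def by (blast intro: bij_betw_same_card)
  then have cV: "card V = card V'" using tree_model_card_eq[OF M] ne by blast
  show ?thesis
  proof (cases "2 \<le> card V")
    case False
    have "card V \<noteq> 0" using M.finite_V M.V_nonempty by simp
    then have "card V = 1" using False by simp
    then obtain r where r: "V = {r}" using card_1_singletonE by blast
    obtain r' where r': "V' = {r'}" using \<open>card V = 1\<close> cV card_1_singletonE by metis
    have "(r, r) \<notin> E" "(r', r') \<notin> E'" using M.arc_neq M'.arc_neq by blast+
    then have "graph_iso V E V' E' (\<lambda>_. r')"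
      unfolding graph_iso_def r r' by (simp add: bij_betw_def)
    then show ?thesis by blast
  next
    case True
    then have V': "2 \<le> card V'" using cV by simp
    have pos: "1 \<le> card A" "1 \<le> card A'"
      using M.sides_nonempty[OF True] M'.sides_nonempty[OF V'] M.finite_A M'.finite_A
      by (simp_all add: Suc_le_eq card_gt_0_iff)
    note deg = graph_iso_ex_degree[OF iso M.HE_subset M'.HE_subset]
    \<comment> \<open>A vertex of degree at least \<open>card V\<close> is the isomorphism-invariant
      mark of the case of two large sides.\<close>
    have big: "3 \<le> card A \<longleftrightarrow> (\<exists>x\<in>HV. card V \<le> card (HE `` {x}))"
    proof
      assume "3 \<le> card A"
      then show "\<exists>x\<in>HV. card V \<le> card (HE `` {x})"
        using M.big_degree_empty ord(1) M.\<pi>_image by (intro bexI[of _ "\<pi> {}"]) auto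
    next
      assume "\<exists>x\<in>HV. card V \<le> card (HE `` {x})"
      then obtain x where x: "x \<in> HV" "card V \<le> card (HE `` {x})" by blast
      show "3 \<le> card A"
      proof (rule ccontr)
        assume "\<not> 3 \<le> card A"
        then have "card A = 1 \<or> card A = 2" using pos(1) by arith
        then show False using M.small_side_degree_le[OF _ True x(1)] x(2) True by fastforce
      qed
    qed
    have big': "3 \<le> card A' \<longleftrightarrow> (\<exists>x\<in>HV'. card V' \<le> card (HE' `` {x}))"
    proof
      assume "3 \<le> card A'"
      then show "\<exists>x\<in>HV'. card V' \<le> card (HE' `` {x})"
        using M'.big_degree_empty ord(2) M'.\<pi>_image by (intro bexI[of _ "\<pi>' {}"]) auto
    next
      assume "\<exists>x\<in>HV'. card V' \<le> card (HE' `` {x})"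
      then obtain x where x: "x \<in> HV'" "card V' \<le> card (HE' `` {x})" by blast
      show "3 \<le> card A'"
      proof (rule ccontr)
        assume "\<not> 3 \<le> card A'"
        then have "card A' = 1 \<or> card A' = 2" using pos(2) by arith
        then show False using M'.small_side_degree_le[OF _ V' x(1)] x(2) V' by fastforce
      qed
    qed
    have big_iff: "3 \<le> card A \<longleftrightarrow> 3 \<le> card A'"
      unfolding big big' using deg[of "\<lambda>k. card V \<le> k"] cV by simp
    \<comment> \<open>Stars have no degree below \<open>card V - 1\<close>, a side of two vertices
      produces one. The ordering of the sides supplies the four vertices that
      \<open>star_degree_ge\<close> asks for.\<close>
    have not_both: "\<not> (card A = 1 \<and> card A' = 2)"
    proof
      assume asm: "card A = 1 \<and> card A' = 2"
      then have "4 \<le> card V" using M'.card_V ord(2) cV by simp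
      then have "\<not> (\<exists>x\<in>HV. card (HE `` {x}) \<le> card V - 2)"
        using M.star_degree_ge asm by fastforce
      moreover have "\<exists>x\<in>HV'. card (HE' `` {x}) \<le> card V - 2"
        using M'.two_ex_small_degree[OF _ V'] asm cV by simp
      ultimately show False using deg[of "\<lambda>k. k \<le> card V - 2"] by blast
    qed
    have not_both': "\<not> (card A = 2 \<and> card A' = 1)"
    proof
      assume asm: "card A = 2 \<and> card A' = 1"
      then have "4 \<le> card V'" using M.card_V ord(1) cV by simp
      then have "\<not> (\<exists>x\<in>HV'. card (HE' `` {x}) \<le> card V' - 2)"
        using M'.star_degree_ge asm by fastforce
      moreover have "\<exists>x\<in>HV. card (HE `` {x}) \<le> card V' - 2"
        using M.two_ex_small_degree[OF _ True] asm cV by simp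
      ultimately show False using deg[of "\<lambda>k. k \<le> card V' - 2"] by blast
    qed
    consider "card A = 1" "card A' = 1" | "card A = 2" "card A' = 2" | "3 \<le> card A" "3 \<le> card A'"
      using pos big_iff not_both not_both' by linarith
    then show ?thesis
    proof cases
      case 1
      then show ?thesis using star_graph_iso[OF bt _ _ cV True] by blast
    next
      case 2
      then show ?thesis using tree_model_two_iso[OF M iso cV] ord by simp
    next
      case 3
      then show ?thesis using tree_model_big_iso[OF M iso cV] ord by simp
    qed
  qed
qed

section \<open>Isomorphic graphs have isomorphic Bell graphs\<close>

lemma stable_partition_subset: "stable_partition k G P \<Longrightarrow> S \<in># P \<Longrightarrow> S \<subseteq> pverts G"
  unfolding stable_partition_def by (elim exE conjE) auto

lemma stable_partition_image:
  assumes iso: "graph_iso (pverts G) (parcs G) (pverts H) (parcs H) f"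
    and "stable_partition k G P"
  shows "stable_partition k H (image_mset ((`) f) P)"
proof -
  have inj: "inj_on f (pverts G)" and im: "f ` pverts G = pverts H"
    and arc: "\<And>u v. u \<in> pverts G \<Longrightarrow> v \<in> pverts G \<Longrightarrow> (u, v) \<in> parcs G \<longleftrightarrow> (f u, f v) \<in> parcs H"
    using iso unfolding graph_iso_def bij_betw_def by auto
  obtain W where W: "P = {# W i. i \<in># mset_set {1..k} #}" "\<forall>i\<in>{1..k}. independent_set G (W i)"
      "disjoint_family_on W {1..k}" "(\<Union>i\<in>{1..k}. W i) = pverts G"
    using assms(2) unfolding stable_partition_def by (elim exE conjE)
  have sub: "W i \<subseteq> pverts G" if "i \<in> {1..k}" for i using W(4) that by blast
  have "independent_set H (f ` W i)" if i: "i \<in> {1..k}" for i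
    unfolding independent_set_def
  proof (intro conjI ballI)
    show "f ` W i \<subseteq> pverts H" using sub[OF i] im by blast
    fix x y assume "x \<in> f ` W i" "y \<in> f ` W i"
    then obtain u v where uv: "u \<in> W i" "v \<in> W i" "x = f u" "y = f v" by blast
    then have "(u, v) \<notin> parcs G" using W(2) i unfolding independent_set_def by blast
    moreover have "u \<in> pverts G" "v \<in> pverts G" using uv sub[OF i] by auto
    ultimately show "(x, y) \<notin> parcs H" using arc uv(3,4) by simp
  qed
  moreover have "disjoint_family_on (\<lambda>i. f ` W i) {1..k}"
    unfolding disjoint_family_on_def
  proof (intro ballI impI)
    fix i j assume ij: "i \<in> {1..k}" "j \<in> {1..k}" "i \<noteq> j"
    then have "W i \<inter> W j = {}" using W(3) unfolding disjoint_family_on_def by blast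
    then show "f ` W i \<inter> f ` W j = {}"
      using inj_on_image_Int[OF inj sub[OF ij(1)] sub[OF ij(2)]] by simp
  qed
  moreover have "(\<Union>i\<in>{1..k}. f ` W i) = pverts H"
    unfolding im[symmetric] W(4)[symmetric] by blast
  moreover have "image_mset ((`) f) P = {# f ` W i. i \<in># mset_set {1..k} #}"
    unfolding W(1) by (simp add: image_mset.compositionality comp_def)
  ultimately show ?thesis
    unfolding stable_partition_def by (intro exI[of _ "\<lambda>i. f ` W i"]) simp
qed

lemma partition_minus_image:
  assumes "inj_on f V" "\<And>S. S \<in># P \<Longrightarrow> S \<subseteq> V" "v \<in> V"
  shows "partition_minus (image_mset ((`) f) P) (f v) = image_mset ((`) f) (partition_minus P v)"
  unfolding partition_minus_def image_mset.compositionality comp_def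
proof (rule image_mset_cong)
  fix S assume "S \<in># P"
  then show "f ` S - {f v} = f ` (S - {v})"
    using inj_on_image_set_diff[OF assms(1), of S "{v}"] assms(2,3) by auto
qed

text \<open>All parts are subsets of \<open>V\<close>, so an inverse of \<open>f\<close> on
  \<open>V\<close> alone undoes the map on partitions.\<close>

lemma image_mset_image_inverse:
  assumes "\<And>x. x \<in> V \<Longrightarrow> g (f x) = x" "\<And>S. S \<in># P \<Longrightarrow> S \<subseteq> V"
  shows "image_mset ((`) g) (image_mset ((`) f) P) = P"
proof -
  have "image_mset (\<lambda>S. g ` f ` S) P = image_mset (\<lambda>S. S) P"
  proof (rule image_mset_cong)
    fix S assume "S \<in># P"
    then have "S \<subseteq> V" by (rule assms(2))
    then show "g ` f ` S = S" using assms(1) by (force simp: image_image)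
  qed
  then show ?thesis by (simp add: image_mset.compositionality comp_def)
qed

lemma bell_graph_arc_image:
  assumes iso: "graph_iso (pverts G) (parcs G) (pverts H) (parcs H) f"
    and PQ: "(P, Q) \<in> parcs (bell_graph k G)"
  shows "(image_mset ((`) f) P, image_mset ((`) f) Q) \<in> parcs (bell_graph k H)"
proof -
  have inj: "inj_on f (pverts G)" and im: "f ` pverts G = pverts H"
    using iso unfolding graph_iso_def bij_betw_def by auto
  have P: "stable_partition k G P" and Q: "stable_partition k G Q" and "P \<noteq> Q"
    using PQ by (auto simp: bell_graph_def)
  obtain v where v: "v \<in> pverts G" "partition_minus P v = partition_minus Q v"
    using PQ by (auto simp: bell_graph_def)
  have "image_mset ((`) f) P \<noteq> image_mset ((`) f) Q"
  proof
    assume "image_mset ((`) f) P = image_mset ((`) f) Q"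
    \<comment> \<open>Each partition is recovered from its image, so distinct partitions keep
      distinct images.\<close>
    moreover have "image_mset ((`) (inv_into (pverts G) f)) (image_mset ((`) f) R) = R"
      if "stable_partition k G R" for R
      using inv_into_f_f[OF inj] stable_partition_subset[OF that] by (rule image_mset_image_inverse)
    ultimately have "P = Q" using P Q by metis
    then show False using \<open>P \<noteq> Q\<close> by simp
  qed
  moreover have "partition_minus (image_mset ((`) f) P) (f v) = partition_minus (image_mset ((`) f) Q) (f v)"
    using partition_minus_image[OF inj stable_partition_subset[OF P] v(1)]
      partition_minus_image[OF inj stable_partition_subset[OF Q] v(1)] v(2) by simp
  moreover have "f v \<in> pverts H" using v(1) im by blast
  ultimately show ?thesis
    using stable_partition_image[OF iso P] stable_partition_image[OF iso Q]
    by (auto simp: bell_graph_def)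
qed

lemma graph_iso_inv_into:
  assumes "graph_iso V E V' E' f"
  shows "graph_iso V' E' V E (inv_into V f)"
proof -
  have bij: "bij_betw f V V'" and arc: "\<And>u v. u \<in> V \<Longrightarrow> v \<in> V \<Longrightarrow> (u, v) \<in> E \<longleftrightarrow> (f u, f v) \<in> E'"
    using assms unfolding graph_iso_def by auto
  have "inv_into V f x \<in> V" "f (inv_into V f x) = x" if "x \<in> V'" for x
    using that bij by (auto simp: bij_betw_def inv_into_into f_inv_into_f)
  then show ?thesis
    using bij_betw_inv_into[OF bij] arc unfolding graph_iso_def by metis
qed

text \<open>Arcs are preserved along \<open>f\<close>, and applying the same fact to its inverse
  shows that they are reflected.\<close>

lemma bell_graph_iso:
  assumes iso: "graph_iso (pverts G) (parcs G) (pverts H) (parcs H) f"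
  shows "\<exists>F. graph_iso (pverts (bell_graph k G)) (parcs (bell_graph k G))
    (pverts (bell_graph k H)) (parcs (bell_graph k H)) F"
proof -
  let ?g = "inv_into (pverts G) f"
  let ?F = "image_mset ((`) f)" and ?G = "image_mset ((`) ?g)"
  note iso' = graph_iso_inv_into[OF iso]
  have bij: "bij_betw f (pverts G) (pverts H)" using iso unfolding graph_iso_def by blast
  have gf: "?g (f x) = x" if "x \<in> pverts G" for x using bij that by (simp add: bij_betw_def)
  have fg: "f (?g y) = y" if "y \<in> pverts H" for y
    using bij that by (auto simp: bij_betw_def f_inv_into_f)
  have GF: "?G (?F P) = P" if "stable_partition k G P" for P
    using gf stable_partition_subset[OF that] by (rule image_mset_image_inverse)
  have FG: "?F (?G P) = P" if "stable_partition k H P" for P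
    using fg stable_partition_subset[OF that] by (rule image_mset_image_inverse)
  have "bij_betw ?F {P. stable_partition k G P} {P. stable_partition k H P}"
    using GF FG stable_partition_image[OF iso] stable_partition_image[OF iso']
    by (intro bij_betw_byWitness[where f' = ?G]) auto
  moreover have "(P, Q) \<in> parcs (bell_graph k G) \<longleftrightarrow> (?F P, ?F Q) \<in> parcs (bell_graph k H)"
    if "stable_partition k G P" "stable_partition k G Q" for P Q
    using bell_graph_arc_image[OF iso, of P Q k] bell_graph_arc_image[OF iso', of "?F P" "?F Q" k]
      GF that by auto
  ultimately have "graph_iso (pverts (bell_graph k G)) (parcs (bell_graph k G))
    (pverts (bell_graph k H)) (parcs (bell_graph k H)) ?F"
    unfolding graph_iso_def by (simp add: bell_graph_def)
  then show ?thesis by blast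
qed

theorem theorem5p9:
  fixes T1 :: "'a pair_pre_digraph" and T2 :: "'b pair_pre_digraph"
  assumes "undirected_tree T1" and "undirected_tree T2"
    and "{card (pverts T1), card (pverts T2)} \<noteq> {1, 2}"
  shows "digraph_iso (with_proj (bell_graph 3 T1)) (with_proj (bell_graph 3 T2)) \<longleftrightarrow>
         digraph_iso (with_proj T1) (with_proj T2)"
proof -
  let ?iso = "\<lambda>G H f. graph_iso (pverts G) (parcs G) (pverts H) (parcs H) f"
  have wf: "parcs T1 \<subseteq> pverts T1 \<times> pverts T1" "parcs T2 \<subseteq> pverts T2 \<times> pverts T2"
    using assms(1,2)[THEN undirected_tree_imp_grown, THEN grown_arcs] .
  have bell_wf: "parcs (bell_graph 3 T1) \<subseteq> pverts (bell_graph 3 T1) \<times> pverts (bell_graph 3 T1)"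
    "parcs (bell_graph 3 T2) \<subseteq> pverts (bell_graph 3 T2) \<times> pverts (bell_graph 3 T2)"
    by (auto simp: bell_graph_def)
  obtain A1 B1 \<pi>1 where M1: "tree_model (pverts T1) (parcs T1) A1 B1
      (pverts (bell_graph 3 T1)) (parcs (bell_graph 3 T1)) \<pi>1" "card A1 \<le> card B1"
    using undirected_tree_model[OF assms(1)] tree_model_ordered by metis
  obtain A2 B2 \<pi>2 where M2: "tree_model (pverts T2) (parcs T2) A2 B2
      (pverts (bell_graph 3 T2)) (parcs (bell_graph 3 T2)) \<pi>2" "card A2 \<le> card B2"
    using undirected_tree_model[OF assms(2)] tree_model_ordered by metis
  have "(\<exists>f. ?iso (bell_graph 3 T1) (bell_graph 3 T2) f) \<longleftrightarrow> (\<exists>f. ?iso T1 T2 f)"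
  proof
    assume "\<exists>f. ?iso (bell_graph 3 T1) (bell_graph 3 T2) f"
    then show "\<exists>f. ?iso T1 T2 f"
      using tree_model_iso[OF M1(1) M2(1) _ assms(3) M1(2) M2(2)] by blast
  next
    assume "\<exists>f. ?iso T1 T2 f"
    then show "\<exists>f. ?iso (bell_graph 3 T1) (bell_graph 3 T2) f"
      using bell_graph_iso by blast
  qed
  then show ?thesis
    unfolding digraph_iso_with_proj_iff[OF bell_wf] digraph_iso_with_proj_iff[OF wf] .
qed

end
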